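(* Let $p$ be a prime and suppose $f(z) \in \overline{\mathbb{F}}_p[z]$ is additive and separable, of degree $p^m$ with $m \geq 1$. Then for each $n \geq 1$ there is an isomorphism of groups \[\mathrm{Mon}_{\overline{\mathbb{F}}_p}(f^n) \cong (\mathbb{Z}/p\mathbb{Z})^{mn},\] and the action of $\mathrm{Mon}_{\overline{\mathbb{F}}_p}(f^n)$ on $f^{-n}(t)$ is free (the stabilizer of every element of $f^{-n}(t)$ is trivial). Moreover, the geometric iterated monodromy group of $f$ satisfies \[\mathrm{IMG}_{\overline{\mathbb{F}}_p}(f) \cong \varprojlim_{n\geq 1} (\mathbb{Z}/p\mathbb{Z})^{mn}.\]
   Context: A polynomial $f \in \overline{\mathbb{F}}_p[z]$ is additive if $f(x+y)=f(x)+f(y)$, equivalently $f(z)=\sum_{i=0}^m a_i z^{p^i}$; it is separable iff $a_0 \neq 0$. $f^n$ denotes the $n$-th iterate of $f$. Let $t$ be transcendental over $\overline{\mathbb{F}}_p$, let $K_n$ be the splitting field of $f^n(z) - t$ over $\overline{\mathbb{F}}_p(t)$, and $f^{-n}(t)$ the set of roots of $f^n(z)-t$ in $K_n$. The monodromy group is $\mathrm{Mon}_{\overline{\mathbb{F}}_p}(f^n) = \mathrm{Gal}(K_n/\overline{\mathbb{F}}_p(t))$, acting on $f^{-n}(t)$. With $K_\infty = \bigcup_n K_n$ (the roots chosen compatibly), the geometric iterated monodromy group is $\mathrm{IMG}_{\overline{\mathbb{F}}_p}(f) = \mathrm{Gal}(K_\infty/\overline{\mathbb{F}}_p(t)) \cong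 \varprojlim_n \mathrm{Mon}_{\overline{\mathbb{F}}_p}(f^n)$. *)

theory Defs
  imports
    "HOL-Analysis.Analysis"
    "HOL-Algebra.Algebra"
    "HOL-Algebra.Algebraic_Closure_Type"
    "Berlekamp_Zassenhaus.Finite_Field"
begin

section \<open>Galois groups inside a fixed overfield\<close>

text \<open>
  The Galois group of \<open>L\<close> over \<open>K\<close>, for subfields \<open>K \<subseteq> L\<close> of an ambient field given as a type.
  As in \<^const>\<open>AutoGroup\<close>, automorphisms are extensional (\<open>undefined\<close> outside \<open>L\<close>), so that each
  is represented exactly once.
\<close>

definition gal_group :: "'a::field set \<Rightarrow> 'a set \<Rightarrow> ('a \<Rightarrow> 'a) monoid" where
  "gal_group L K = BijGroup L
     \<lparr>carrier := {\<sigma> \<in> Bij L.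
        \<sigma> \<in> Ring.ring_hom (ring_of_type_algebra\<lparr>carrier := L\<rparr>) (ring_of_type_algebra\<lparr>carrier := L\<rparr>)
        \<and> (\<forall>x\<in>K. \<sigma> x = x)}\<rparr>"

text \<open>
  The Krull topology on \<open>gal_group L K\<close> (for \<open>L\<close> algebraic over \<open>K\<close>), described as the topology of
  pointwise convergence on the discrete set \<open>L\<close>.
\<close>

definition krull_topology :: "'a::field set \<Rightarrow> 'a set \<Rightarrow> ('a \<Rightarrow> 'a) topology" where
  "krull_topology L K =
     subtopology (product_topology (\<lambda>_. discrete_topology L) L) (carrier (gal_group L K))"


section \<open>Inverse limits of groups\<close>

text \<open>
  \<open>\<pi> i j : G j \<rightarrow> G i\<close> for \<open>i \<le> j\<close> are the transition maps.
\<close>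

definition inverse_limit ::
  "'i::order set \<Rightarrow> ('i \<Rightarrow> 'b monoid) \<Rightarrow> ('i \<Rightarrow> 'i \<Rightarrow> 'b \<Rightarrow> 'b) \<Rightarrow> ('i \<Rightarrow> 'b) monoid" where
  "inverse_limit I G \<pi> = product_group I G
     \<lparr>carrier := {x \<in> carrier (product_group I G).
        \<forall>i\<in>I. \<forall>j\<in>I. i \<le> j \<longrightarrow> \<pi> i j (x j) = x i}\<rparr>"

text \<open>The inverse limit topology, each \<open>G i\<close> being discrete.\<close>

definition inverse_limit_topology ::
  "'i::order set \<Rightarrow> ('i \<Rightarrow> 'b monoid) \<Rightarrow> ('i \<Rightarrow> 'i \<Rightarrow> 'b \<Rightarrow> 'b) \<Rightarrow> ('i \<Rightarrow> 'b) topology" where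
  "inverse_limit_topology I G \<pi> =
     subtopology (product_topology (\<lambda>i. discrete_topology (carrier (G i))) I)
       (carrier (inverse_limit I G \<pi>))"

definition Zmod_power :: "nat \<Rightarrow> nat \<Rightarrow> (nat \<Rightarrow> int) monoid" where
  "Zmod_power p d = product_group {..<d} (\<lambda>_. integer_mod_group p)"

definition first_coords :: "nat \<Rightarrow> (nat \<Rightarrow> int) \<Rightarrow> (nat \<Rightarrow> int)" where
  "first_coords d x = restrict x {..<d}"


section \<open>Iterated monodromy groups of polynomials\<close>

definition additive_poly :: "'k::field poly \<Rightarrow> bool" where
  "additive_poly f \<longleftrightarrow> (\<forall>x y. poly f (x + y) = poly f x + poly f y)"

definition iterate_poly :: "'k::field poly \<Rightarrow> nat \<Rightarrow> 'k poly" where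
  "iterate_poly f n = (pcompose f ^^ n) [:0, 1:]"

text \<open>
  The rational function field \<open>k(t)\<close> is \<open>'k poly fract\<close>, and all splitting fields are formed inside
  one fixed algebraic closure of it.
\<close>

type_synonym 'k omega = "'k poly fract alg_closure"

definition const_omega :: "'k::field \<Rightarrow> 'k omega" where
  "const_omega c = to_ac (to_fract [:c:])"

definition t_omega :: "'k::field omega" where
  "t_omega = to_ac (to_fract [:0, 1:])"

definition base_field :: "'k::field omega set" where
  "base_field = range to_ac"

definition preimages :: "'k::field poly \<Rightarrow> nat \<Rightarrow> 'k omega set" where
  "preimages f n = {\<alpha>. poly (map_poly const_omega (iterate_poly f n) - [:t_omega:]) \<alpha> = 0}"

definition splitting :: "'k::field poly \<Rightarrow> nat \<Rightarrow> 'k omega set" where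
  "splitting f n = generate_field ring_of_type_algebra (base_field \<union> preimages f n)"

definition Mon :: "'k::field poly \<Rightarrow> nat \<Rightarrow> ('k omega \<Rightarrow> 'k omega) monoid" where
  "Mon f n = gal_group (splitting f n) base_field"

definition mon_action ::
  "'k::field poly \<Rightarrow> nat \<Rightarrow> ('k omega \<Rightarrow> 'k omega) \<Rightarrow> ('k omega \<Rightarrow> 'k omega)" where
  "mon_action f n \<sigma> = restrict \<sigma> (preimages f n)"

text \<open>
  The splitting fields form an increasing chain inside the fixed closure when \<open>f\<close> is nonconstant, so
  their union is the field \<open>K\<^sub>\<infinity>\<close>.
\<close>

definition splitting_inf :: "'k::field poly \<Rightarrow> 'k omega set" where
  "splitting_inf f = (\<Union>n\<in>{1..}. splitting f n)"

definition IMG :: "'k::field poly \<Rightarrow> ('k omega \<Rightarrow> 'k omega) monoid" where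
  "IMG f = gal_group (splitting_inf f) base_field"

definition IMG_topology :: "'k::field poly \<Rightarrow> ('k omega \<Rightarrow> 'k omega) topology" where
  "IMG_topology f = krull_topology (splitting_inf f) base_field"


section \<open>Galois groups are groups\<close>

lemma gal_group_mem:
  "\<sigma> \<in> carrier (gal_group L K) \<longleftrightarrow> \<sigma> \<in> Bij L \<and> \<sigma> 1 = 1
     \<and> (\<forall>x\<in>L. \<forall>y\<in>L. \<sigma> (x + y) = \<sigma> x + \<sigma> y \<and> \<sigma> (x * y) = \<sigma> x * \<sigma> y) \<and> (\<forall>x\<in>K. \<sigma> x = x)"
  using Bij_imp_funcset[of \<sigma> L]
  by (auto simp: gal_group_def Ring.ring_hom_def ring_of_type_algebra_def)

lemma subgroup_gal_group:
  fixes L K :: "'a::field set"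
  assumes L: "subring L (ring_of_type_algebra :: 'a ring)" and KL: "K \<subseteq> L"
  shows "subgroup (carrier (gal_group L K)) (BijGroup L)"
proof -
  let ?R = "ring_of_type_algebra :: 'a ring"
  have one: "1 \<in> L"
    using subringE(3)[OF L] by (simp add: ring_of_type_algebra_def)
  have add: "x + y \<in> L" if "x \<in> L" "y \<in> L" for x y
    using subringE(7)[OF L that] by (simp add: ring_of_type_algebra_def)
  have mult: "x * y \<in> L" if "x \<in> L" "y \<in> L" for x y
    using subringE(6)[OF L that] by (simp add: ring_of_type_algebra_def)
  show ?thesis
  proof (rule subgroup.intro)
    show "carrier (gal_group L K) \<subseteq> carrier (BijGroup L)"
      by (auto simp: gal_group_mem BijGroup_def)
  next
    fix s t assume s: "s \<in> carrier (gal_group L K)" and t: "t \<in> carrier (gal_group L K)"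
    have sL: "s x \<in> L" and tL: "t x \<in> L" if "x \<in> L" for x
      using that s t by (auto simp: gal_group_mem dest!: Bij_imp_funcset)
    have "compose L s t \<in> carrier (gal_group L K)"
      using s t one KL sL tL by (auto simp: gal_group_mem compose_Bij compose_eq add mult)
    then show "s \<otimes>\<^bsub>BijGroup L\<^esub> t \<in> carrier (gal_group L K)"
      using s t by (auto simp: BijGroup_def gal_group_mem)
  next
    show "\<one>\<^bsub>BijGroup L\<^esub> \<in> carrier (gal_group L K)"
      using one KL by (auto simp: BijGroup_def gal_group_mem id_Bij add mult)
  next
    fix s assume s: "s \<in> carrier (gal_group L K)"
    then have sB: "s \<in> Bij L" by (simp add: gal_group_mem)
    have inj: "inj_on s L" using sB by (simp add: Bij_def bij_betw_def)
    have "inv_into L s (x + y) = inv_into L s x + inv_into L s y"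
      if "x \<in> L" "y \<in> L" for x y
      using s sB that add by (intro Bij_inv_into_lemma) (auto simp: gal_group_mem)
    moreover have "inv_into L s (x * y) = inv_into L s x * inv_into L s y"
      if "x \<in> L" "y \<in> L" for x y
      using s sB that mult by (intro Bij_inv_into_lemma) (auto simp: gal_group_mem)
    moreover have "inv_into L s x = x" if "x \<in> K \<or> x = 1" for x
      using s that KL one inj by (intro inv_into_f_eq) (auto simp: gal_group_mem)
    ultimately have "(\<lambda>x\<in>L. inv_into L s x) \<in> carrier (gal_group L K)"
      using sB one KL by (auto simp: gal_group_mem restrict_inv_into_Bij add mult)
    then show "inv\<^bsub>BijGroup L\<^esub> s \<in> carrier (gal_group L K)"
      using sB by (simp add: inv_BijGroup)
  qed
qed

lemma group_gal_group:
  fixes L K :: "'a::field set"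
  assumes "subring L (ring_of_type_algebra :: 'a ring)" and "K \<subseteq> L"
  shows "group (gal_group L K)"
  using subgroup.subgroup_is_group[OF subgroup_gal_group[OF assms] group_BijGroup]
  by (simp add: gal_group_def)

lemma subfield_splitting: "subfield (splitting f n) ring_of_type_algebra"
  unfolding splitting_def
  by (rule field.generate_field_is_subfield[OF field_from_type_algebra])
     (simp add: ring_of_type_algebra_def)

lemma base_field_splitting: "base_field \<subseteq> splitting f n"
  by (auto simp: splitting_def intro: generate_field.incl)

lemma preimages_splitting: "preimages f n \<subseteq> splitting f n"
  by (auto simp: splitting_def intro: generate_field.incl)

lemma group_Mon: "group (Mon f n)"
  unfolding Mon_def
  by (intro group_gal_group subfieldE(1) subfield_splitting base_field_splitting)

end

theory Submission
  imports Defs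
begin

text \<open>
  Write \<open>k\<close> for the constant field and choose a compatible chain \<open>\<alpha> 0 = t\<close>, \<open>f (\<alpha> (n + 1)) = \<alpha> n\<close>. By
  additivity \<open>f\<^sup>-\<^sup>n(t) = \<alpha> n + W n\<close> with \<open>W n = ker (f ^^ n) \<subseteq> k\<close>, so \<open>K\<^sub>n = k(\<alpha> n)\<close>, and \<open>\<alpha> n\<close> is
  transcendental over \<open>k\<close> because \<open>t\<close> is. An automorphism \<open>\<sigma>\<close> is determined by its displacement
  \<open>\<sigma> (\<alpha> n) - \<alpha> n \<in> W n\<close>, which is additive in \<open>\<sigma>\<close> since \<open>\<sigma>\<close> fixes \<open>W n\<close>; conversely every \<open>w \<in> W n\<close>
  occurs, the substitution \<open>\<alpha> n \<mapsto> \<alpha> n + w\<close> of the rational function field \<open>k(\<alpha> n)\<close> fixing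
  \<open>t = (f ^^ n) (\<alpha> n)\<close>. Hence no irreducibility or degree argument is needed. In the limit,
  \<open>Gal(K\<^sub>\<infinity>/k(t))\<close> is the inverse limit of the \<open>W n\<close> along \<open>f\<close>, and pulling a basis of \<open>W 1\<close> back
  along \<open>f\<close> identifies \<open>f : W (n + 1) \<rightarrow> W n\<close> with the projection of \<open>(\<int>/p)\<close>-coordinates onto the first
  \<open>m n\<close> of them.
\<close>

section \<open>Subfields and algebraically closed fields\<close>

lemma algebra_ring_simps:
  "carrier (ring_of_type_algebra :: 'a::field ring) = UNIV"
  "\<one>\<^bsub>ring_of_type_algebra :: 'a ring\<^esub> = 1"
  "\<zero>\<^bsub>ring_of_type_algebra :: 'a ring\<^esub> = 0"
  "x \<oplus>\<^bsub>ring_of_type_algebra :: 'a ring\<^esub> y = x + y"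
  "x \<otimes>\<^bsub>ring_of_type_algebra :: 'a ring\<^esub> y = x * y"
  by (simp_all add: ring_of_type_algebra_def)

lemma algebra_ring_uminus: "\<ominus>\<^bsub>ring_of_type_algebra\<^esub> (x :: 'a::field) = - x"
proof -
  interpret field "ring_of_type_algebra :: 'a ring" by (rule field_from_type_algebra)
  show ?thesis
    using minus_equality[of "- x" x] by (simp add: algebra_ring_simps)
qed

lemma algebra_ring_inverse:
  assumes "(x :: 'a::field) \<noteq> 0"
  shows "inv\<^bsub>ring_of_type_algebra\<^esub> x = inverse x"
proof -
  interpret field "ring_of_type_algebra :: 'a ring" by (rule field_from_type_algebra)
  show ?thesis
    using comm_inv_char[of x "inverse x"] assms by (simp add: algebra_ring_simps)
qed

lemma subring_algebra_ring_iff: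
  fixes K :: "'a::field set"
  shows "subring K ring_of_type_algebra \<longleftrightarrow>
    1 \<in> K \<and> (\<forall>x\<in>K. - x \<in> K) \<and> (\<forall>x\<in>K. \<forall>y\<in>K. x + y \<in> K \<and> x * y \<in> K)"
proof -
  interpret field "ring_of_type_algebra :: 'a ring" by (rule field_from_type_algebra)
  show ?thesis
  proof
    assume K: "subring K (ring_of_type_algebra :: 'a ring)"
    show "1 \<in> K \<and> (\<forall>x\<in>K. - x \<in> K) \<and> (\<forall>x\<in>K. \<forall>y\<in>K. x + y \<in> K \<and> x * y \<in> K)"
      using subringE(3)[OF K] subringE(5)[OF K] subringE(6)[OF K] subringE(7)[OF K]
      unfolding algebra_ring_simps algebra_ring_uminus by blast
  next
    assume "1 \<in> K \<and> (\<forall>x\<in>K. - x \<in> K) \<and> (\<forall>x\<in>K. \<forall>y\<in>K. x + y \<in> K \<and> x * y \<in> K)"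
    then show "subring K (ring_of_type_algebra :: 'a ring)"
      by (intro subringI) (simp_all add: algebra_ring_simps algebra_ring_uminus)
  qed
qed

lemma subfield_algebra_ring_iff:
  fixes K :: "'a::field set"
  shows "subfield K ring_of_type_algebra \<longleftrightarrow>
    subring K ring_of_type_algebra \<and> (\<forall>x\<in>K. inverse x \<in> K)"
proof -
  interpret field "ring_of_type_algebra :: 'a ring" by (rule field_from_type_algebra)
  have zero: "0 \<in> K" if "subring K ring_of_type_algebra"
    using subringE(2)[OF that] by (simp add: algebra_ring_simps)
  show ?thesis
  proof
    assume K: "subfield K ring_of_type_algebra"
    have "inverse x \<in> K" if "x \<in> K" for x
      using subfield_m_inv(1)[OF K, of x] that
      by (cases "x = 0") (auto simp: algebra_ring_simps algebra_ring_inverse)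
    then show "subring K ring_of_type_algebra \<and> (\<forall>x\<in>K. inverse x \<in> K)"
      using subfieldE(1)[OF K] by blast
  next
    assume "subring K ring_of_type_algebra \<and> (\<forall>x\<in>K. inverse x \<in> K)"
    then show "subfield K ring_of_type_algebra"
      by (intro subfieldI') (auto simp: algebra_ring_simps algebra_ring_inverse)
  qed
qed

lemma subfield_closed:
  fixes K :: "'a::field set"
  assumes "subfield K ring_of_type_algebra"
  shows "0 \<in> K" "1 \<in> K"
    and "x \<in> K \<Longrightarrow> - x \<in> K" "x \<in> K \<Longrightarrow> inverse x \<in> K"
    and "x \<in> K \<Longrightarrow> y \<in> K \<Longrightarrow> x + y \<in> K" "x \<in> K \<Longrightarrow> y \<in> K \<Longrightarrow> x - y \<in> K"
    and "x \<in> K \<Longrightarrow> y \<in> K \<Longrightarrow> x * y \<in> K" "x \<in> K \<Longrightarrow> y \<in> K \<Longrightarrow> x / y \<in> K"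
proof -
  note K = assms[unfolded subfield_algebra_ring_iff subring_algebra_ring_iff]
  show "0 \<in> K"
    using subringE(2)[OF subfieldE(1)[OF assms]] by (simp add: algebra_ring_simps)
  show "1 \<in> K"
    using K by blast
  show neg: "- x \<in> K" if "x \<in> K" for x
    using K that by blast
  show inv: "inverse x \<in> K" if "x \<in> K" for x
    using K that by blast
  show add: "x + y \<in> K" if "x \<in> K" "y \<in> K" for x y
    using K that by blast
  show mult: "x * y \<in> K" if "x \<in> K" "y \<in> K" for x y
    using K that by blast
  show "x - y \<in> K" if "x \<in> K" "y \<in> K" for x y
    using add[OF that(1) neg[OF that(2)]] by simp
  show "x / y \<in> K" if "x \<in> K" "y \<in> K" for x y
    using mult[OF that(1) inv[OF that(2)]] by (simp add: divide_inverse)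
qed

text \<open>In a finite field the product of all linear factors vanishes everywhere, so adding 1
  gives a nonconstant polynomial without a root. Infinitude later turns equalities of values on
  \<open>k\<close> into equalities of polynomials.\<close>

lemma infinite_alg_closed: "infinite (UNIV :: 'a::alg_closed_field set)"
proof
  assume fin: "finite (UNIV :: 'a set)"
  define Q :: "'a poly" where "Q = (\<Prod>a\<in>UNIV. [:- a, 1:])"
  have "Polynomial.degree Q = (\<Sum>a\<in>(UNIV :: 'a set). Polynomial.degree [:- a, 1:])"
    unfolding Q_def by (rule degree_prod_sum_eq) simp
  then have "Polynomial.degree Q = card (UNIV :: 'a set)"
    by simp
  moreover have "card (UNIV :: 'a set) > 0"
    using fin by (simp only: card_gt_0_iff) simp
  ultimately have "Polynomial.degree (1 + Q) > 0"
    by (metis degree_1 degree_add_eq_right)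
  then obtain x where "poly (1 + Q) x = 0"
    using alg_closed_imp_poly_has_root by blast
  moreover have "poly Q x = 0"
    unfolding Q_def poly_prod by (rule prod_zero[OF fin], rule bexI[of _ x]) simp_all
  ultimately show False by simp
qed

lemma poly_surj_alg_closed:
  fixes P :: "'a::alg_closed_field poly"
  assumes "Polynomial.degree P > 0"
  obtains x where "poly P x = y"
proof -
  have "Polynomial.degree (P + [:- y:]) > 0"
    using assms by (subst degree_add_eq_left) simp_all
  then obtain x where "poly (P + [:- y:]) x = 0"
    using alg_closed_imp_poly_has_root by blast
  then show thesis
    by (intro that) simp
qed

text \<open>Over an algebraically closed field the multiset of roots has as many members as the
  degree, and squarefreeness makes every multiplicity 1. This is how separability fixes the size of
  the kernel of \<open>f\<close>.\<close>

lemma card_roots_rsquarefree: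
  fixes P :: "'a::alg_closed_field poly"
  assumes "rsquarefree P"
  shows "card {x. poly P x = 0} = Polynomial.degree P"
proof -
  have P0: "P \<noteq> 0" using assms by (simp add: rsquarefree_def)
  obtain A where A: "size A = Polynomial.degree P" "P = Polynomial.smult (Polynomial.lead_coeff P) (\<Prod>x\<in>#A. [:-x, 1:])"
    using alg_closed_imp_factorization[OF P0] by blast
  have nz: "(\<Prod>x\<in>#B. [:- x, 1:] :: 'a poly) \<noteq> 0" for B
    by (induction B) (simp_all del: mult_pCons_left)
  have "proots (\<Prod>x\<in>#A. [:- x, 1:]) = A"
  proof (induction A)
    case (add x A)
    have "[:- x, 1:] * (\<Prod>x\<in>#A. [:- x, 1:]) \<noteq> 0"
      using nz[of "add_mset x A"] by (simp del: mult_pCons_left)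
    then show ?case
      using add.IH by (simp add: proots_mult del: mult_pCons_left)
  qed simp
  then have "proots P = A"
    using A(2) P0 by (metis leading_coeff_0_iff proots_smult)
  then have "Polynomial.degree P = size (proots P)"
    using A(1) by simp
  also have "\<dots> = (\<Sum>x\<in>{x. poly P x = 0}. Polynomial.order x P)"
    using P0 by (simp add: size_multiset_overloaded_eq)
  also have "\<dots> = (\<Sum>x\<in>{x. poly P x = 0}. 1)"
    using rsquarefree_root_order[OF assms _ P0] by (intro sum.cong) auto
  finally show ?thesis
    by simp
qed

section \<open>Evaluating constant polynomials in the closure of the rational function field\<close>

lemma const_omega_simps [simp]:
  fixes a b :: "'k::field"
  shows "const_omega (0 :: 'k) = 0" "const_omega (1 :: 'k) = 1"
    "const_omega (a + b) = const_omega a + const_omega b"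
    "const_omega (a * b) = const_omega a * const_omega b"
    "const_omega (- a) = - const_omega a"
    "const_omega (a - b) = const_omega a - const_omega b"
    "const_omega a = const_omega b \<longleftrightarrow> a = b"
    "const_omega a = 0 \<longleftrightarrow> a = 0"
proof -
  show add: "const_omega (a + b) = const_omega a + const_omega b" for a b :: 'k
    unfolding const_omega_def by (metis add.right_neutral add_pCons to_ac_add to_fract_add)
  show "const_omega (a * b) = const_omega a * const_omega b"
    unfolding const_omega_def
    by (simp flip: to_fract_mult to_ac_mult) 
  show zero: "const_omega (0 :: 'k) = 0" and one: "const_omega (1 :: 'k) = 1"
    by (simp_all add: const_omega_def flip: one_pCons)
  show neg: "const_omega (- a) = - const_omega a" for a :: 'k
    using add[of a "- a"] zero by (simp add: eq_neg_iff_add_eq_0 add.commute)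
  show "const_omega (a - b) = const_omega a - const_omega b"
    using add[of a "- b"] neg by simp
  show "const_omega a = const_omega b \<longleftrightarrow> a = b"
    and "const_omega a = 0 \<longleftrightarrow> a = 0"
    by (simp_all add: const_omega_def)
qed

interpretation const_omega: inj_idom_hom "const_omega :: 'k::field \<Rightarrow> 'k omega"
  by unfold_locales simp_all

interpretation map_poly_const_omega: map_poly_inj_idom_hom "const_omega :: 'k::field \<Rightarrow> 'k omega" ..

text \<open>Embedding only the coefficients makes evaluation a ring homomorphism in the polynomial
  and turns composition into substitution, so identities in the closure can be checked on
  polynomials over \<open>k\<close>.\<close>

definition ev :: "'k::field poly \<Rightarrow> 'k omega \<Rightarrow> 'k omega" where
  "ev P x = poly (map_poly const_omega P) x"

lemma ev_simps [simp]:
  "ev 0 x = 0" "ev 1 x = 1" "ev (P + Q) x = ev P x + ev Q x" "ev (P - Q) x = ev P x - ev Q x"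
  "ev (- P) x = - ev P x" "ev (P * Q) x = ev P x * ev Q x"
  "ev (pCons a P) x = const_omega a + x * ev P x"
  by (simp_all add: ev_def hom_distribs)

lemma ev_smult [simp]: "ev (Polynomial.smult c P) x = const_omega c * ev P x"
  using ev_simps(6)[of "[:c:]" P x] by simp

lemma ev_pcompose [simp]: "ev (pcompose P Q) x = ev P (ev Q x)"
  by (induction P) (simp_all add: pcompose_pCons)

lemma ev_const_omega [simp]: "ev P (const_omega c) = const_omega (poly P c)"
  by (induction P) simp_all

lemma ev_t_omega: "ev P t_omega = to_ac (to_fract P)"
proof (induction P)
  case (pCons a P)
  have "to_fract (pCons a P) = to_fract [:a:] + to_fract [:0, 1:] * to_fract P"
    by (simp flip: to_fract_mult to_fract_add)
  moreover have "ev (pCons a P) t_omega = to_ac (to_fract [:a:]) + to_ac (to_fract [:0, 1:]) * ev P t_omega"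
    by (simp add: const_omega_def t_omega_def)
  ultimately show ?case
    by (simp add: pCons.IH)
qed simp

lemma t_omega_transcendental: "t_omega \<notin> range const_omega"
proof
  assume "t_omega \<in> range (const_omega :: 'a \<Rightarrow> _)"
  then obtain c :: 'a where "t_omega = const_omega c" by blast
  then show False
    by (simp add: t_omega_def const_omega_def)
qed

text \<open>\<open>P\<close> splits into linear factors over the algebraically closed
  \<open>k\<close>, so a root of a nonzero \<open>P\<close> is a constant. Hence
  \<open>x \<notin> range const_omega\<close> serves as transcendence over \<open>k\<close>
  throughout.\<close>

lemma ev_eq_0_iff:
  fixes P :: "'k::alg_closed_field poly"
  assumes "x \<notin> range const_omega"
  shows "ev P x = 0 \<longleftrightarrow> P = 0"
proof
  assume ev0: "ev P x = 0"
  show "P = 0"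
  proof (rule ccontr)
    assume P0: "P \<noteq> 0"
    then obtain A where A: "P = Polynomial.smult (Polynomial.lead_coeff P) (\<Prod>a\<in>#A. [:- a, 1:])"
      using alg_closed_imp_factorization by blast
    have "ev (\<Prod>a\<in>#A. [:- a, 1:]) x = (\<Prod>a\<in>#A. x - const_omega a)"
      by (induction A) (simp_all add: algebra_simps)
    then have "ev P x = const_omega (Polynomial.lead_coeff P) * (\<Prod>a\<in>#A. x - const_omega a)"
      by (subst A) simp
    moreover have "const_omega (Polynomial.lead_coeff P) \<noteq> 0"
      using P0 by simp
    ultimately have "(\<Prod>a\<in>#A. x - const_omega a) = 0"
      using ev0 by simp
    then obtain a where "x - const_omega a = 0"
      by (auto simp: prod_mset_zero_iff)
    then show False
      using assms by (simp add: image_iff)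
  qed
qed simp

section \<open>Simple rational function fields inside the closure\<close>

definition rat_field :: "'k::field omega \<Rightarrow> 'k omega set" where
  "rat_field x = {ev P x / ev Q x | P Q. Q \<noteq> 0}"

lemma base_field_eq: "base_field = rat_field t_omega"
proof (intro subset_antisym subsetI)
  fix y :: "'a omega" assume "y \<in> base_field"
  then obtain r where r: "y = to_ac r" by (auto simp: base_field_def)
  obtain P Q where "r = Fract P Q" "Q \<noteq> 0" by (cases r)
  then show "y \<in> rat_field t_omega"
    unfolding rat_field_def ev_t_omega r by (auto simp: Fract_conv_to_fract)
next
  fix y :: "'a omega" assume "y \<in> rat_field t_omega"
  then show "y \<in> base_field"
    unfolding rat_field_def ev_t_omega base_field_def by (auto simp flip: to_ac_divide)
qed

lemma const_omega_in_rat_field: "const_omega c \<in> rat_field x"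
  unfolding rat_field_def by (rule CollectI, rule exI[of _ "[:c:]"], rule exI[of _ 1]) simp

lemma generator_in_rat_field: "x \<in> rat_field x"
  unfolding rat_field_def by (rule CollectI, rule exI[of _ "[:0, 1:]"], rule exI[of _ 1]) simp

lemma const_omega_in_base_field: "const_omega c \<in> base_field"
  by (simp add: base_field_eq const_omega_in_rat_field)

text \<open>Since \<open>x\<close> is not a constant, a denominator that is nonzero as a polynomial
  stays nonzero at \<open>x\<close>, so fractions can be brought to a common denominator.\<close>

lemma subfield_rat_field:
  fixes x :: "'k::alg_closed_field omega"
  assumes x: "x \<notin> range const_omega"
  shows "subfield (rat_field x) ring_of_type_algebra"
  unfolding subfield_algebra_ring_iff subring_algebra_ring_iff
proof (intro conjI ballI)
  show "1 \<in> rat_field x"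
    using const_omega_in_rat_field[of 1 x] by simp
next
  fix y assume "y \<in> rat_field x"
  then obtain P Q where y: "y = ev P x / ev Q x" "Q \<noteq> 0" by (auto simp: rat_field_def)
  have "- y = ev (- P) x / ev Q x" using y by simp
  then show "- y \<in> rat_field x" using y unfolding rat_field_def by blast
  show "inverse y \<in> rat_field x"
  proof (cases "P = 0")
    \<comment> \<open>Here \<open>inverse 0 = 0\<close> is the default value of the total inverse,
      and it is covered by the constant 0.\<close>
    case True
    then have "inverse y = const_omega 0" using y by simp
    then show ?thesis using const_omega_in_rat_field by metis
  next
    case False
    have "inverse y = ev Q x / ev P x" using y by simp
    then show ?thesis using False unfolding rat_field_def by blast
  qed
next
  fix y z assume "y \<in> rat_field x" "z \<in> rat_field x"
  then obtain P Q R S where y: "y = ev P x / ev Q x" "Q \<noteq> 0" and z: "z = ev R x / ev S x" "S \<noteq> 0"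
    unfolding rat_field_def by blast
  have nz: "ev Q x \<noteq> 0" "ev S x \<noteq> 0"
    using y z ev_eq_0_iff[OF x] by blast+
  have "y + z = ev (P * S + R * Q) x / ev (Q * S) x"
    using nz y z by (simp add: add_frac_eq)
  moreover have "y * z = ev (P * R) x / ev (Q * S) x"
    using y z by simp
  moreover have "Q * S \<noteq> 0" using y z by simp
  ultimately show "y + z \<in> rat_field x" "y * z \<in> rat_field x"
    unfolding rat_field_def by blast+
qed

lemma ev_in_subfield:
  assumes K: "subfield K ring_of_type_algebra" and "range const_omega \<subseteq> K" and "x \<in> K"
  shows "ev P x \<in> K"
proof (induction P)
  case 0
  show ?case
    using subfield_closed(1)[OF K] by simp
next
  case (pCons a P)
  have "const_omega a + x * ev P x \<in> K"
    using assms(2,3) by (intro subfield_closed(5,7)[OF K] pCons.IH) blast+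
  then show ?case
    by simp
qed

lemma rat_field_subset:
  assumes "subfield K ring_of_type_algebra" and "range const_omega \<subseteq> K" and "x \<in> K"
  shows "rat_field x \<subseteq> K"
proof
  fix y assume "y \<in> rat_field x"
  then obtain P Q where "y = ev P x / ev Q x"
    unfolding rat_field_def by blast
  then show "y \<in> K"
    using subfield_closed(8)[OF assms(1) ev_in_subfield[OF assms] ev_in_subfield[OF assms]] by blast
qed

text \<open>Both \<open>x\<close> and \<open>y\<close> being transcendental, \<open>x \<mapsto> y\<close> extends to an isomorphism of the rational
  function fields they generate; this is the well-definedness part.\<close>

lemma ev_quotient_transfer:
  fixes x y :: "'k::alg_closed_field omega"
  assumes x: "x \<notin> range const_omega" and y: "y \<notin> range const_omega"
    and Q: "Q \<noteq> 0" "S \<noteq> 0" and eq: "ev P x / ev Q x = ev R x / ev S x"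
  shows "ev P y / ev Q y = ev R y / ev S y"
proof -
  have nz: "ev Q x \<noteq> 0" "ev S x \<noteq> 0" "ev Q y \<noteq> 0" "ev S y \<noteq> 0"
    using Q ev_eq_0_iff[OF x] ev_eq_0_iff[OF y] by blast+
  have "ev (P * S - R * Q) x = 0"
    using eq[unfolded frac_eq_eq[OF nz(1,2)]] by simp
  then have "P * S - R * Q = 0"
    using ev_eq_0_iff[OF x] by blast
  then have "ev (P * S - R * Q) y = 0"
    by (simp only: ev_simps)
  then show ?thesis
    unfolding frac_eq_eq[OF nz(3,4)] by simp
qed

section \<open>Additive maps and elementary rules for Galois automorphisms\<close>

lemma poly_eq_0_infinite:
  fixes P :: "'a::idom poly"
  assumes "infinite A" and "\<And>a. a \<in> A \<Longrightarrow> poly P a = 0"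
  shows "P = 0"
proof (rule ccontr)
  assume "P \<noteq> 0"
  then have "finite {x. poly P x = 0}"
    by (rule poly_roots_finite)
  moreover have "A \<subseteq> {x. poly P x = 0}"
    using assms(2) by blast
  ultimately show False
    using assms(1) finite_subset by blast
qed

text \<open>Repeated addition and negation pass through an additive map. In positive characteristic
  this makes its kernel a vector space over the prime field.\<close>

lemma additive_of_int_mult:
  fixes h :: "'a::ring_1 \<Rightarrow> 'b::ring_1"
  assumes "Modules.additive h"
  shows "h (of_int n * x) = of_int n * h x"
proof -
  interpret Modules.additive h by fact
  have "h (of_nat k * x) = of_nat k * h x" for k
    by (induction k) (simp_all add: zero add distrib_right)
  then show ?thesis
    by (cases n rule: int_cases2) (simp_all add: minus)
qed

lemma additive_funpow:
  fixes h :: "'a::ab_group_add \<Rightarrow> 'a"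
  assumes "Modules.additive h"
  shows "Modules.additive (h ^^ n)"
proof -
  interpret Modules.additive h by fact
  show ?thesis
  proof
    show "(h ^^ n) (x + y) = (h ^^ n) x + (h ^^ n) y" for x y
      by (induction n) (simp_all add: add)
  qed
qed

lemma gal_groupD:
  assumes "\<sigma> \<in> carrier (gal_group L K)"
  shows "\<sigma> \<in> Bij L" "\<sigma> \<in> extensional L" "\<sigma> 1 = 1"
    and "\<And>x. x \<in> L \<Longrightarrow> \<sigma> x \<in> L"
    and "\<And>x y. x \<in> L \<Longrightarrow> y \<in> L \<Longrightarrow> \<sigma> (x + y) = \<sigma> x + \<sigma> y"
    and "\<And>x y. x \<in> L \<Longrightarrow> y \<in> L \<Longrightarrow> \<sigma> (x * y) = \<sigma> x * \<sigma> y"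
    and "\<And>x. x \<in> K \<Longrightarrow> \<sigma> x = x"
proof -
  show B: "\<sigma> \<in> Bij L" "\<sigma> 1 = 1"
    and "\<And>x y. x \<in> L \<Longrightarrow> y \<in> L \<Longrightarrow> \<sigma> (x + y) = \<sigma> x + \<sigma> y"
    and "\<And>x y. x \<in> L \<Longrightarrow> y \<in> L \<Longrightarrow> \<sigma> (x * y) = \<sigma> x * \<sigma> y"
    and "\<And>x. x \<in> K \<Longrightarrow> \<sigma> x = x"
    using assms unfolding gal_group_mem by blast+
  show "\<sigma> \<in> extensional L"
    using B(1) by (rule Bij_imp_extensional)
  show "\<And>x. x \<in> L \<Longrightarrow> \<sigma> x \<in> L"
    using Bij_imp_funcset[OF B(1)] by blast
qed

lemma gal_group_mult:
  assumes "\<sigma> \<in> carrier (gal_group L K)" "\<tau> \<in> carrier (gal_group L K)"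
  shows "\<sigma> \<otimes>\<^bsub>gal_group L K\<^esub> \<tau> = compose L \<sigma> \<tau>"
  using gal_groupD(1)[OF assms(1)] gal_groupD(1)[OF assms(2)]
  by (simp add: gal_group_def BijGroup_def)

lemma gal_group_divide:
  assumes \<sigma>: "\<sigma> \<in> carrier (gal_group L K)" and L: "subfield L ring_of_type_algebra"
    and xy: "x \<in> L" "y \<in> L" "y \<noteq> 0"
  shows "\<sigma> (x / y) = \<sigma> x / \<sigma> y"
proof -
  have "\<sigma> y * \<sigma> (inverse y) = \<sigma> (y * inverse y)"
    using gal_groupD(6)[OF \<sigma> xy(2) subfield_closed(4)[OF L xy(2)]] by simp
  also have "\<dots> = 1"
    using xy(3) gal_groupD(3)[OF \<sigma>] by simp
  finally have "\<sigma> (inverse y) = inverse (\<sigma> y)"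
    by (metis inverse_unique)
  then show ?thesis
    using gal_groupD(6)[OF \<sigma> xy(1) subfield_closed(4)[OF L xy(2)]] by (simp add: divide_inverse)
qed

text \<open>The coefficients lie in \<open>base_field\<close>, which \<sigma> fixes pointwise, so
  only the argument moves. Every statement below about the effect of \<sigma> on preimages of
  \<open>t_omega\<close> rests on this.\<close>

lemma gal_group_ev:
  assumes \<sigma>: "\<sigma> \<in> carrier (gal_group L base_field)" and L: "subfield L ring_of_type_algebra"
    and KL: "base_field \<subseteq> L" and x: "x \<in> L"
  shows "\<sigma> (ev P x) = ev P (\<sigma> x)"
proof (induction P)
  case 0
  show ?case
    using gal_groupD(7)[OF \<sigma> const_omega_in_base_field[of 0]] by simp
next
  case (pCons a P)
  have "range const_omega \<subseteq> L"
    by (rule image_subsetI, rule subsetD[OF KL], rule const_omega_in_base_field)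
  then have ev: "ev P x \<in> L" and a: "const_omega a \<in> L"
    using ev_in_subfield[OF L _ x] by blast+
  have "\<sigma> (ev (pCons a P) x) = \<sigma> (const_omega a) + \<sigma> (x * ev P x)"
    using gal_groupD(5)[OF \<sigma> a subfield_closed(7)[OF L x ev]] by simp
  also have "\<dots> = const_omega a + \<sigma> x * \<sigma> (ev P x)"
    using gal_groupD(6)[OF \<sigma> x ev] gal_groupD(7)[OF \<sigma> const_omega_in_base_field[of a]] by simp
  finally show ?case
    using pCons.IH by simp
qed

lemma preimages_eq: "preimages f n = {x. (ev f ^^ n) x = t_omega}"
  and ev_iterate_poly [simp]: "ev (iterate_poly f n) x = (ev f ^^ n) x"
proof -
  have "ev (iterate_poly f n) x = (ev f ^^ n) x" for x
    unfolding iterate_poly_def by (induction n) simp_all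
  then show "preimages f n = {x. (ev f ^^ n) x = t_omega}" "ev (iterate_poly f n) x = (ev f ^^ n) x"
    by (auto simp: preimages_def ev_def)
qed

lemma const_omega_splitting: "range const_omega \<subseteq> splitting f n"
  by (rule image_subsetI, rule subsetD[OF base_field_splitting], rule const_omega_in_base_field)

lemma funpow_ev_const_omega: "(ev f ^^ n) (const_omega c) = const_omega ((poly f ^^ n) c)"
  by (induction n) simp_all

section \<open>The tower of splitting fields of a separable additive polynomial\<close>

text \<open>The derivative of an additive polynomial is its coefficient of z, so for such a nonzero
  \<open>f\<close> simplicity of all roots (\<open>rsquarefree\<close>) says exactly that this
  coefficient is nonzero.\<close>

locale separable_additive =
  fixes f :: "'k::alg_closed_field poly" and m :: nat
  assumes char_pos: "CHAR('k) > 0"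
    and additive: "additive_poly f"
    and rsquarefree: "rsquarefree f"
    and degree: "Polynomial.degree f = CHAR('k) ^ m"
begin

lemma degree_pos: "Polynomial.degree f > 0"
  using degree char_pos by simp

lemma additive_poly_f: "Modules.additive (poly f)"
  using additive by unfold_locales (simp add: additive_poly_def)

text \<open>Additivity is assumed only for values in \<open>k\<close>. It is carried to the closure
  one variable at a time, because a polynomial with infinitely many roots is zero.\<close>

lemma additive_ev_f: "Modules.additive (ev f)"
proof
  fix x y :: "'k omega"
  have const: "ev f (const_omega c + z) = const_omega (poly f c) + ev f z" for c z
  proof -
    \<comment> \<open>With the first argument a constant \<open>c\<close>, additivity becomes a
      polynomial identity over \<open>k\<close>, which may then be evaluated at any
      \<open>z\<close>.\<close>
    have "pcompose f [:c, 1:] - f - [:poly f c:] = 0"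
      using additive by (intro poly_eq_0_infinite[OF infinite_alg_closed])
        (simp add: poly_pcompose additive_poly_def)
    then have "ev (pcompose f [:c, 1:] - f - [:poly f c:]) z = 0"
      by simp
    then show ?thesis
      by (simp add: algebra_simps)
  qed
  define G where "G = map_poly const_omega f"
  have inf: "infinite (range (const_omega :: 'k \<Rightarrow> _))"
    using infinite_alg_closed finite_imageD[of const_omega UNIV] const_omega_simps(7)
    by (metis injI)
  \<comment> \<open>Now \<open>x\<close> is arbitrary and the coefficients lie in the closure;
    \<open>const\<close> makes the polynomial vanish at every constant.\<close>
  have "pcompose G [:x, 1:] - G - [:ev f x:] = 0"
  proof (rule poly_eq_0_infinite[OF inf])
    fix a :: "'k omega" assume "a \<in> range const_omega"
    then obtain c where "a = const_omega c" by blast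
    then show "poly (pcompose G [:x, 1:] - G - [:ev f x:]) a = 0"
      using const[of c x] ev_const_omega[of f c]
      by (simp add: G_def poly_pcompose add.commute flip: ev_def)
  qed
  then have "poly (pcompose G [:x, 1:] - G - [:ev f x:]) y = 0"
    by (simp only: poly_0)
  then show "ev f (x + y) = ev f x + ev f y"
    by (simp add: G_def poly_pcompose algebra_simps flip: ev_def)
qed

sublocale poly_pow: Modules.additive "poly f ^^ n" for n
  by (rule additive_funpow[OF additive_poly_f])

sublocale ev_pow: Modules.additive "ev f ^^ n" for n
  by (rule additive_funpow[OF additive_ev_f])

section \<open>Iterated kernels, compatible preimages of \<open>t_omega\<close> and their splitting
  fields\<close>

definition iter_kernel :: "nat \<Rightarrow> 'k set" where
  "iter_kernel n = {w. (poly f ^^ n) w = 0}"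

primrec tower :: "nat \<Rightarrow> 'k omega" where
  "tower 0 = t_omega"
| "tower (Suc n) = (SOME y. ev f y = tower n)"

lemma ev_tower: "ev f (tower (Suc n)) = tower n"
proof -
  have "Polynomial.degree (map_poly const_omega f) > 0"
    using degree_pos by simp
  then have "\<exists>y. ev f y = tower n"
    unfolding ev_def by (metis poly_surj_alg_closed)
  then show ?thesis
    unfolding tower.simps by (rule someI_ex)
qed

lemma funpow_tower: "i \<le> j \<Longrightarrow> (ev f ^^ (j - i)) (tower j) = tower i"
proof (induction rule: dec_induct)
  case (step j)
  then show ?case
    by (simp only: Suc_diff_le funpow_Suc_right comp_apply ev_tower)
qed simp

lemma tower_in_preimages: "tower n \<in> preimages f n"
  using funpow_tower[of 0 n] by (simp add: preimages_eq)

text \<open>Iterating \<open>f\<close> keeps a constant constant, whereas \<open>t_omega\<close> is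
  not one.\<close>

lemma preimages_transcendental:
  assumes "x \<in> preimages f n"
  shows "x \<notin> range const_omega"
proof
  assume "x \<in> range const_omega"
  then obtain c where "x = const_omega c" by blast
  then have "t_omega = const_omega ((poly f ^^ n) c)"
    using assms by (simp add: preimages_eq funpow_ev_const_omega)
  then show False
    using t_omega_transcendental by blast
qed

text \<open>By additivity two preimages differ by a root of \<open>iterate_poly f n\<close>, and a
  nonzero polynomial over \<open>k\<close> has only constant roots in the closure.\<close>

lemma preimages_iff_translate:
  assumes x: "x \<in> preimages f n"
  shows "y \<in> preimages f n \<longleftrightarrow> (\<exists>w\<in>iter_kernel n. y = x + const_omega w)"
proof
  assume "y \<in> preimages f n"
  then have 0: "(ev f ^^ n) (y - x) = 0"
    using x by (simp add: preimages_eq ev_pow.diff)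
  \<comment> \<open>The iterate takes the value \<open>t_omega\<close> at \<open>x\<close>, which is
    not the constant 0.\<close>
  have "iterate_poly f n \<noteq> 0"
  proof
    assume "iterate_poly f n = 0"
    then have "t_omega = const_omega (0 :: 'k)"
      using x ev_iterate_poly[of f n x] by (simp add: preimages_eq)
    then show False
      using t_omega_transcendental by blast
  qed
  then have "y - x \<in> range const_omega"
    using 0 ev_eq_0_iff[of "y - x" "iterate_poly f n"] by auto
  then obtain w where w: "y - x = const_omega w" by blast
  then have "w \<in> iter_kernel n"
    using 0 by (simp add: funpow_ev_const_omega iter_kernel_def)
  moreover have "y = x + const_omega w"
    using w by (metis add_diff_cancel_left' diff_add_cancel add.commute)
  ultimately show "\<exists>w\<in>iter_kernel n. y = x + const_omega w" by blast
next
  assume "\<exists>w\<in>iter_kernel n. y = x + const_omega w"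
  then show "y \<in> preimages f n"
    using x by (auto simp: preimages_eq ev_pow.add funpow_ev_const_omega iter_kernel_def)
qed

text \<open>All preimages are constant translates of \<open>x\<close>, and \<open>t_omega\<close> is
  a polynomial in \<open>x\<close>. Allowing any preimage, and not only \<open>tower n\<close>,
  later shows that translations preserve the splitting field.\<close>

lemma splitting_eq_rat_field:
  assumes x: "x \<in> preimages f n"
  shows "splitting f n = rat_field x"
proof (rule subset_antisym)
  let ?R = "ring_of_type_algebra :: 'k omega ring"
  note S = subfield_rat_field[OF preimages_transcendental[OF x]]
  have const: "range const_omega \<subseteq> rat_field x"
    by (rule image_subsetI) (rule const_omega_in_rat_field)
  have "t_omega \<in> rat_field x"
    using ev_in_subfield[OF S const generator_in_rat_field, of "iterate_poly f n"] x
    by (simp add: preimages_eq)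
  then have "base_field \<subseteq> rat_field x"
    unfolding base_field_eq by (rule rat_field_subset[OF S const])
  moreover have "preimages f n \<subseteq> rat_field x"
  proof
    fix y assume "y \<in> preimages f n"
    then obtain w where "y = x + const_omega w"
      using preimages_iff_translate[OF x] by blast
    then show "y \<in> rat_field x"
      using subfield_closed(5)[OF S generator_in_rat_field const_omega_in_rat_field] by blast
  qed
  ultimately show "splitting f n \<subseteq> rat_field x"
    unfolding splitting_def
    by (intro field.generate_field_min_subfield1[OF field_from_type_algebra _ S])
      (simp_all add: algebra_ring_simps)
  note const_omega_splitting[of f n]
  moreover have "x \<in> splitting f n"
    using preimages_splitting x by blast
  ultimately show "rat_field x \<subseteq> splitting f n"
    by (rule rat_field_subset[OF subfield_splitting])
qed

text \<open>\<open>tower i\<close> is the value at \<open>tower j\<close> of a polynomial over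
  \<open>k\<close>.\<close>

lemma splitting_mono:
  assumes "i \<le> j"
  shows "splitting f i \<subseteq> splitting f j"
proof -
  note const = const_omega_splitting[of f j]
  have "ev (iterate_poly f (j - i)) (tower j) \<in> splitting f j"
    using preimages_splitting tower_in_preimages
    by (intro ev_in_subfield[OF subfield_splitting const]) blast
  then show ?thesis
    unfolding splitting_eq_rat_field[OF tower_in_preimages[of i]]
    using funpow_tower[OF assms] by (intro rat_field_subset[OF subfield_splitting const]) simp
qed

text \<open>A single \<open>K\<^sub>n\<close> is the case \<open>I = {n}\<close>, and \<open>K\<^sub>\<infinity>\<close> is the case \<open>I = {1..}\<close>.\<close>

definition tower_field :: "nat set \<Rightarrow> 'k omega set" where
  "tower_field I = (\<Union>i\<in>I. splitting f i)"

text \<open>The splitting fields form a chain, so the larger of two levels contains both elements.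
  Field laws and automorphism laws thereby reduce to one level.\<close>

lemma tower_field_common:
  assumes "x \<in> tower_field I" "y \<in> tower_field I"
  obtains i where "i \<in> I" "x \<in> splitting f i" "y \<in> splitting f i"
proof -
  obtain i j where ij: "i \<in> I" "x \<in> splitting f i" "j \<in> I" "y \<in> splitting f j"
    using assms by (auto simp: tower_field_def)
  show thesis
  proof (cases "i \<le> j")
    case True
    then show thesis using ij that[of j] splitting_mono by blast
  next
    case False
    then show thesis using ij that[of i] splitting_mono[of j i] by auto
  qed
qed

lemma splitting_subset_tower_field: "i \<in> I \<Longrightarrow> splitting f i \<subseteq> tower_field I"
  by (auto simp: tower_field_def)

lemma base_field_subset_tower_field: "I \<noteq> {} \<Longrightarrow> base_field \<subseteq> tower_field I"
  using base_field_splitting splitting_subset_tower_field by blast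

lemma preimages_subset_tower_field: "i \<in> I \<Longrightarrow> preimages f i \<subseteq> tower_field I"
  using preimages_splitting splitting_subset_tower_field by blast

lemma subfield_tower_field:
  assumes "I \<noteq> {}"
  shows "subfield (tower_field I) ring_of_type_algebra"
  unfolding subfield_algebra_ring_iff subring_algebra_ring_iff
proof (intro conjI ballI)
  note closed = subfield_closed[OF subfield_splitting[of f]]
  show "1 \<in> tower_field I"
    using assms closed(2) by (auto simp: tower_field_def)
  show "- x \<in> tower_field I" "inverse x \<in> tower_field I" if "x \<in> tower_field I" for x
    using that closed(3,4) unfolding tower_field_def by blast+
  fix x y assume "x \<in> tower_field I" "y \<in> tower_field I"
  then obtain i where "i \<in> I" "x \<in> splitting f i" "y \<in> splitting f i"
    by (rule tower_field_common)
  then show "x + y \<in> tower_field I" "x * y \<in> tower_field I"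
    using closed(5,7) splitting_subset_tower_field by blast+
qed

section \<open>Translation automorphisms and displacements\<close>

text \<open>An element of the inverse limit of the kernels along \<open>f\<close>, indexed by
  \<open>I\<close>, with values outside \<open>I\<close> left free. For \<open>I = {n}\<close> it
  amounts to one element of \<open>iter_kernel n\<close>.\<close>

definition coherent :: "nat set \<Rightarrow> (nat \<Rightarrow> 'k) \<Rightarrow> bool" where
  "coherent I w \<longleftrightarrow> (\<forall>i\<in>I. w i \<in> iter_kernel i)
     \<and> (\<forall>i\<in>I. \<forall>j\<in>I. i \<le> j \<longrightarrow> (poly f ^^ (j - i)) (w j) = w i)"

lemma coherentD:
  assumes "coherent I w"
  shows "i \<in> I \<Longrightarrow> w i \<in> iter_kernel i"
    and "i \<in> I \<Longrightarrow> j \<in> I \<Longrightarrow> i \<le> j \<Longrightarrow> (poly f ^^ (j - i)) (w j) = w i"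
proof -
  have "\<forall>i\<in>I. w i \<in> iter_kernel i"
    "\<forall>i\<in>I. \<forall>j\<in>I. i \<le> j \<longrightarrow> (poly f ^^ (j - i)) (w j) = w i"
    using assms unfolding coherent_def by simp_all
  note * = this[rule_format]
  show "i \<in> I \<Longrightarrow> w i \<in> iter_kernel i"
    by (rule *(1))
  show "i \<in> I \<Longrightarrow> j \<in> I \<Longrightarrow> i \<le> j \<Longrightarrow> (poly f ^^ (j - i)) (w j) = w i"
    by (rule *(2))
qed

lemma coherent_uminus:
  assumes "coherent I w"
  shows "coherent I (\<lambda>i. - w i)"
  unfolding coherent_def
proof (intro conjI ballI impI)
  show "- w i \<in> iter_kernel i" if "i \<in> I" for i
    using coherentD(1)[OF assms that] by (simp add: iter_kernel_def poly_pow.minus)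
  show "(poly f ^^ (j - i)) (- w j) = - w i" if "i \<in> I" "j \<in> I" "i \<le> j" for i j
    unfolding poly_pow.minus coherentD(2)[OF assms that] ..
qed

lemma translate_in_preimages:
  assumes "coherent I w" "i \<in> I"
  shows "tower i + const_omega (w i) \<in> preimages f i"
  unfolding preimages_iff_translate[OF tower_in_preimages]
  by (rule bexI[of _ "w i"], rule refl, rule coherentD(1)[OF assms])

text \<open>The substitution of \<open>tower i + const_omega (w i)\<close> for
  \<open>tower i\<close> in any fraction that represents \<open>x\<close> at any level of
  \<open>I\<close>. Independence of these choices is settled in
  \<open>translate_aut_eq\<close>.\<close>

definition translate_aut :: "nat set \<Rightarrow> (nat \<Rightarrow> 'k) \<Rightarrow> 'k omega \<Rightarrow> 'k omega" where
  "translate_aut I w x = (THE y. \<exists>i\<in>I. \<exists>P Q. Q \<noteq> 0 \<and> x = ev P (tower i) / ev Q (tower i)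
     \<and> y = ev P (tower i + const_omega (w i)) / ev Q (tower i + const_omega (w i)))"

text \<open>Two fractions for the same element, possibly at different levels, are compared at the
  higher level, where \<open>ev_quotient_transfer\<close> applies.\<close>

lemma translate_aut_eq:
  assumes w: "coherent I w" and i: "i \<in> I" and Q: "Q \<noteq> 0"
  shows "translate_aut I w (ev P (tower i) / ev Q (tower i))
    = ev P (tower i + const_omega (w i)) / ev Q (tower i + const_omega (w i))"
proof -
  let ?\<beta> = "\<lambda>i. tower i + const_omega (w i)"
  have le: "ev P (?\<beta> i) / ev Q (?\<beta> i) = ev R (?\<beta> j) / ev S (?\<beta> j)"
    if ij: "i \<in> I" "j \<in> I" "i \<le> j" and QS: "Q \<noteq> 0" "S \<noteq> 0"
      and eq: "ev P (tower i) / ev Q (tower i) = ev R (tower j) / ev S (tower j)"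
    for i j P Q R S
  proof -
    \<comment> \<open>\<open>g\<close> expresses the lower generator through the higher one, and
      coherence of \<open>w\<close> makes it do the same for the translated generators.\<close>
    define g where "g = iterate_poly f (j - i)"
    have ti: "tower i = ev g (tower j)"
      using funpow_tower[OF ij(3)] by (simp add: g_def)
    have \<beta>i: "?\<beta> i = ev g (?\<beta> j)"
      using funpow_tower[OF ij(3)] coherentD(2)[OF w ij]
      by (simp add: g_def ev_pow.add funpow_ev_const_omega)
    \<comment> \<open>One nonzero value shows that the composed denominator is a nonzero
      polynomial.\<close>
    have "ev (pcompose Q g) (tower j) \<noteq> 0"
      using ev_eq_0_iff[OF preimages_transcendental[OF tower_in_preimages[of i]]] QS(1)
      by (simp flip: ti)
    then have Qg: "pcompose Q g \<noteq> 0"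
      using ev_simps(1) by metis
    show ?thesis
      using ev_quotient_transfer[where P = "pcompose P g" and R = R,
          OF preimages_transcendental[OF tower_in_preimages[of j]]
          preimages_transcendental[OF translate_in_preimages[OF w ij(2)]] Qg QS(2)] eq
      by (simp only: ev_pcompose ti[symmetric] \<beta>i[symmetric])
  qed
  show ?thesis
    unfolding translate_aut_def
  proof (rule the_equality)
    show "\<exists>j\<in>I. \<exists>R S. S \<noteq> 0 \<and> ev P (tower i) / ev Q (tower i) = ev R (tower j) / ev S (tower j)
        \<and> ev P (?\<beta> i) / ev Q (?\<beta> i) = ev R (?\<beta> j) / ev S (?\<beta> j)"
      using i Q by blast
  next
    fix y
    assume "\<exists>j\<in>I. \<exists>R S. S \<noteq> 0 \<and> ev P (tower i) / ev Q (tower i) = ev R (tower j) / ev S (tower j)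
        \<and> y = ev R (?\<beta> j) / ev S (?\<beta> j)"
    then obtain j R S where *: "j \<in> I" "S \<noteq> 0"
      "ev P (tower i) / ev Q (tower i) = ev R (tower j) / ev S (tower j)"
      "y = ev R (?\<beta> j) / ev S (?\<beta> j)"
      by blast
    show "y = ev P (?\<beta> i) / ev Q (?\<beta> i)"
    proof (cases "i \<le> j")
      case True
      show ?thesis
        using le[OF i *(1) True Q *(2) *(3)] *(4) by (rule trans[OF _ sym, rotated])
    next
      case False
      then have "j \<le> i" by simp
      show ?thesis
        unfolding *(4) by (rule le[OF *(1) i \<open>j \<le> i\<close> *(2) Q *(3)[symmetric]])
    qed
  qed
qed

lemma splitting_tower_cases:
  assumes "x \<in> splitting f i"
  obtains P Q where "Q \<noteq> 0" "x = ev P (tower i) / ev Q (tower i)"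
proof -
  have "\<exists>P Q. x = ev P (tower i) / ev Q (tower i) \<and> Q \<noteq> 0"
    using assms unfolding splitting_eq_rat_field[OF tower_in_preimages] rat_field_def
    by (rule CollectD)
  then show thesis
    using that by (elim exE conjE)
qed

lemma translate_aut_tower:
  assumes "coherent I w" "i \<in> I"
  shows "translate_aut I w (tower i) = tower i + const_omega (w i)"
  using translate_aut_eq[OF assms, of 1 "[:0, 1:]"] by simp

text \<open>The image lies in the field generated by the translated generator; that generator is
  again a preimage, so the field is the same.\<close>

lemma translate_aut_splitting:
  assumes w: "coherent I w" and i: "i \<in> I" and x: "x \<in> splitting f i"
  shows "translate_aut I w x \<in> splitting f i"
proof -
  obtain P Q where Q: "Q \<noteq> 0" and x: "x = ev P (tower i) / ev Q (tower i)"
    by (rule splitting_tower_cases[OF x])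
  show ?thesis
    unfolding x translate_aut_eq[OF w i Q]
      splitting_eq_rat_field[OF translate_in_preimages[OF w i]] rat_field_def
    using Q by blast
qed

text \<open>Translating by \<open>w i\<close> amounts to composing numerator and denominator with z
  + \<open>w i\<close>, and the negated family undoes this shift. It supplies the inverse
  automorphism.\<close>

lemma translate_aut_uminus:
  assumes w: "coherent I w" and i: "i \<in> I" and x: "x \<in> splitting f i"
  shows "translate_aut I (\<lambda>i. - w i) (translate_aut I w x) = x"
proof -
  obtain P Q where Q: "Q \<noteq> 0" and x: "x = ev P (tower i) / ev Q (tower i)"
    by (rule splitting_tower_cases[OF x])
  let ?T = "[:w i, 1:]"
  have "ev (pcompose Q ?T) (tower i) \<noteq> 0"
    using Q ev_eq_0_iff[OF preimages_transcendental[OF translate_in_preimages[OF w i]]]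
    by (simp add: add.commute)
  then have QT: "pcompose Q ?T \<noteq> 0"
    using ev_simps(1) by metis
  have "translate_aut I w x = ev (pcompose P ?T) (tower i) / ev (pcompose Q ?T) (tower i)"
    unfolding x translate_aut_eq[OF w i Q] by (simp add: add.commute)
  also have "translate_aut I (\<lambda>i. - w i) \<dots> = x"
    unfolding translate_aut_eq[OF coherent_uminus[OF w] i QT] x by simp
  finally show ?thesis .
qed

text \<open>The ring laws are read off from fractions at a common level, and bijectivity comes from
  translation by the negated family.\<close>

lemma translate_aut_in_gal_group:
  assumes w: "coherent I w" and I: "I \<noteq> {}"
  shows "restrict (translate_aut I w) (tower_field I) \<in> carrier (gal_group (tower_field I) base_field)"
    (is "restrict ?\<sigma> ?L \<in> _")
  unfolding gal_group_mem
proof (intro conjI ballI)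
  note L = subfield_tower_field[OF I]
  have into: "translate_aut I v x \<in> ?L" if "coherent I v" "x \<in> ?L" for v x
    using that translate_aut_splitting[OF that(1)] unfolding tower_field_def by blast
  have inv1: "translate_aut I (\<lambda>i. - w i) (?\<sigma> x) = x" if "x \<in> ?L" for x
    using that translate_aut_uminus[OF w] unfolding tower_field_def by blast
  have inv2: "?\<sigma> (translate_aut I (\<lambda>i. - w i) x) = x" if "x \<in> ?L" for x
    using that translate_aut_uminus[OF coherent_uminus[OF w]] unfolding tower_field_def by auto
  have "bij_betw ?\<sigma> ?L ?L"
    by (rule bij_betw_byWitness[where f' = "translate_aut I (\<lambda>i. - w i)"])
      (use into[OF w] into[OF coherent_uminus[OF w]] inv1 inv2 in blast)+
  then show "restrict ?\<sigma> ?L \<in> Bij ?L"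
    by (simp add: Bij_def bij_betw_restrict_eq)
  show fixed: "restrict ?\<sigma> ?L x = x" if "x \<in> base_field" for x
  proof -
    obtain i where i: "i \<in> I" using I by blast
    obtain P Q where Q: "Q \<noteq> 0" and x: "x = ev P t_omega / ev Q t_omega"
      using \<open>x \<in> base_field\<close> unfolding base_field_eq rat_field_def by blast
    \<comment> \<open>\<open>t_omega\<close> is the value of \<open>g\<close> both at
      \<open>tower i\<close> and at its translate, so an element of the base field written through
      \<open>g\<close> is unaffected by the substitution.\<close>
    define g where "g = iterate_poly f i"
    have t: "ev g (tower i) = t_omega" "ev g (tower i + const_omega (w i)) = t_omega"
      using tower_in_preimages translate_in_preimages[OF w i] by (simp_all add: preimages_eq g_def)
    have "ev (pcompose Q g) (tower i) \<noteq> 0"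
      using ev_eq_0_iff[OF t_omega_transcendental, of Q] Q by (simp add: t)
    then have Qg: "pcompose Q g \<noteq> 0"
      using ev_simps(1) by metis
    have "?\<sigma> x = x"
      using translate_aut_eq[OF w i Qg, of "pcompose P g"] by (simp add: t x)
    then show ?thesis
      using \<open>x \<in> base_field\<close> base_field_subset_tower_field[OF I] by auto
  qed
  show "restrict ?\<sigma> ?L 1 = 1"
    using fixed[OF const_omega_in_base_field[of 1]] by simp
  fix x y assume xy: "x \<in> ?L" "y \<in> ?L"
  then obtain i where i: "i \<in> I" "x \<in> splitting f i" "y \<in> splitting f i"
    by (rule tower_field_common)
  obtain P Q where Q: "Q \<noteq> 0" and x: "x = ev P (tower i) / ev Q (tower i)"
    by (rule splitting_tower_cases[OF i(2)])
  obtain R S where S: "S \<noteq> 0" and y: "y = ev R (tower i) / ev S (tower i)"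
    by (rule splitting_tower_cases[OF i(3)])
  have QS: "Q * S \<noteq> 0" using Q S by simp
  note ne = ev_eq_0_iff[OF preimages_transcendental[OF tower_in_preimages[of i]]]
    ev_eq_0_iff[OF preimages_transcendental[OF translate_in_preimages[OF w i(1)]]]
  have "x + y = ev (P * S + R * Q) (tower i) / ev (Q * S) (tower i)"
    unfolding x y using Q S ne by (simp add: add_frac_eq)
  then have "?\<sigma> (x + y) = ?\<sigma> x + ?\<sigma> y"
    unfolding x y translate_aut_eq[OF w i(1) Q] translate_aut_eq[OF w i(1) S]
    using translate_aut_eq[OF w i(1) QS, of "P * S + R * Q"] Q S ne by (simp add: add_frac_eq)
  then show "restrict ?\<sigma> ?L (x + y) = restrict ?\<sigma> ?L x + restrict ?\<sigma> ?L y"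
    using xy subfield_closed(5)[OF L xy] by simp
  have "x * y = ev (P * R) (tower i) / ev (Q * S) (tower i)"
    unfolding x y by simp
  then have "?\<sigma> (x * y) = ?\<sigma> x * ?\<sigma> y"
    unfolding x y translate_aut_eq[OF w i(1) Q] translate_aut_eq[OF w i(1) S]
    using translate_aut_eq[OF w i(1) QS, of "P * R"] by simp
  then show "restrict ?\<sigma> ?L (x * y) = restrict ?\<sigma> ?L x * restrict ?\<sigma> ?L y"
    using xy subfield_closed(7)[OF L xy] by simp
qed

section \<open>Arbitrary Galois automorphisms and their displacements\<close>

abbreviation tower_gal :: "nat set \<Rightarrow> ('k omega \<Rightarrow> 'k omega) monoid" where
  "tower_gal I \<equiv> gal_group (tower_field I) base_field"

lemma tower_gal_ev:
  assumes "\<sigma> \<in> carrier (tower_gal I)" "I \<noteq> {}" "x \<in> tower_field I"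
  shows "\<sigma> (ev P x) = ev P (\<sigma> x)"
  using gal_group_ev[OF assms(1) subfield_tower_field base_field_subset_tower_field] assms by blast

lemma tower_gal_preimages:
  assumes "\<sigma> \<in> carrier (tower_gal I)" "i \<in> I" "x \<in> preimages f i"
  shows "\<sigma> x \<in> preimages f i"
proof -
  have "I \<noteq> {}" "x \<in> tower_field I"
    using assms preimages_subset_tower_field by blast+
  then have "\<sigma> (ev (iterate_poly f i) x) = ev (iterate_poly f i) (\<sigma> x)"
    using tower_gal_ev assms(1) by blast
  moreover have "\<sigma> t_omega = t_omega"
    using generator_in_rat_field by (intro gal_groupD(7)[OF assms(1)]) (simp add: base_field_eq)
  ultimately show ?thesis
    using assms(3) by (simp add: preimages_eq)
qed

text \<open>Level \<open>i\<close> is generated over \<open>k\<close> by any single preimage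
  \<open>x\<close>. Taking \<open>x = tower i\<close> yields injectivity of displacements, and
  arbitrary \<open>x\<close> yields freeness of the action.\<close>

lemma tower_gal_determined:
  assumes \<sigma>: "\<sigma> \<in> carrier (tower_gal I)" and \<tau>: "\<tau> \<in> carrier (tower_gal I)"
    and i: "i \<in> I" and x: "x \<in> preimages f i" and eq: "\<sigma> x = \<tau> x" and y: "y \<in> splitting f i"
  shows "\<sigma> y = \<tau> y"
proof -
  have I: "I \<noteq> {}" using i by blast
  obtain P Q where Q: "Q \<noteq> 0" and y: "y = ev P x / ev Q x"
    using y unfolding splitting_eq_rat_field[OF x] rat_field_def by blast
  have xL: "x \<in> tower_field I"
    using x i preimages_subset_tower_field by blast
  have "range const_omega \<subseteq> tower_field I"
    using const_omega_splitting splitting_subset_tower_field[OF i] by (rule subset_trans)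
  then have ev: "ev R x \<in> tower_field I" for R
    using ev_in_subfield[OF subfield_tower_field[OF I] _ xL] by blast
  have ne: "ev Q x \<noteq> 0"
    using Q ev_eq_0_iff[OF preimages_transcendental[OF x]] by blast
  have *: "\<rho> y = ev P (\<rho> x) / ev Q (\<rho> x)" if "\<rho> \<in> carrier (tower_gal I)" for \<rho>
    unfolding y gal_group_divide[OF that subfield_tower_field[OF I] ev ev ne]
      tower_gal_ev[OF that I xL] ..
  show ?thesis
    unfolding *[OF \<sigma>] *[OF \<tau>] eq ..
qed

text \<open>The description is unique because \<open>const_omega\<close> is injective; for Galois
  automorphisms a witness exists because all preimages are translates of
  \<open>tower i\<close>.\<close>

definition displacement :: "nat \<Rightarrow> ('k omega \<Rightarrow> 'k omega) \<Rightarrow> 'k" where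
  "displacement i \<sigma> = (THE w. \<sigma> (tower i) = tower i + const_omega w)"

lemma displacementI: "\<sigma> (tower i) = tower i + const_omega w \<Longrightarrow> displacement i \<sigma> = w"
  unfolding displacement_def by simp

lemma displacement:
  assumes "\<sigma> \<in> carrier (tower_gal I)" "i \<in> I"
  shows "displacement i \<sigma> \<in> iter_kernel i"
    and "\<sigma> (tower i) = tower i + const_omega (displacement i \<sigma>)"
proof -
  obtain w where w: "w \<in> iter_kernel i" "\<sigma> (tower i) = tower i + const_omega w"
    using tower_gal_preimages[OF assms tower_in_preimages] preimages_iff_translate[OF tower_in_preimages]
    by blast
  then show "displacement i \<sigma> \<in> iter_kernel i"
    "\<sigma> (tower i) = tower i + const_omega (displacement i \<sigma>)"
    using w displacementI[of \<sigma> i w] by simp_all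
qed

text \<open>\<sigma> fixes the constant by which \<tau> moves \<open>tower i\<close>, so the shifts
  add up.\<close>

lemma displacement_mult:
  assumes \<sigma>: "\<sigma> \<in> carrier (tower_gal I)" and \<tau>: "\<tau> \<in> carrier (tower_gal I)" and i: "i \<in> I"
  shows "displacement i (\<sigma> \<otimes>\<^bsub>tower_gal I\<^esub> \<tau>) = displacement i \<sigma> + displacement i \<tau>"
proof (rule displacementI)
  have t: "tower i \<in> tower_field I"
    using tower_in_preimages preimages_subset_tower_field[OF i] by blast
  have c: "const_omega w \<in> tower_field I" for w
    using const_omega_splitting[of f i] splitting_subset_tower_field[OF i] by blast
  have "(\<sigma> \<otimes>\<^bsub>tower_gal I\<^esub> \<tau>) (tower i) = \<sigma> (tower i + const_omega (displacement i \<tau>))"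
    using displacement(2)[OF \<tau> i] t by (simp add: gal_group_mult[OF \<sigma> \<tau>] compose_eq)
  also have "\<dots> = \<sigma> (tower i) + const_omega (displacement i \<tau>)"
    using gal_groupD(5)[OF \<sigma> t c] gal_groupD(7)[OF \<sigma> const_omega_in_base_field] by simp
  finally show "(\<sigma> \<otimes>\<^bsub>tower_gal I\<^esub> \<tau>) (tower i)
      = tower i + const_omega (displacement i \<sigma> + displacement i \<tau>)"
    using displacement(2)[OF \<sigma> i] by (simp add: add.assoc)
qed

text \<open>\<open>tower i\<close> is an iterate of \<open>f\<close> at \<open>tower j\<close>, and
  \<sigma> commutes with that iterate; comparing the two shifts gives compatibility.\<close>

lemma coherent_displacement:
  assumes \<sigma>: "\<sigma> \<in> carrier (tower_gal I)"
  shows "coherent I (\<lambda>i. displacement i \<sigma>)"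
  unfolding coherent_def
proof (intro conjI ballI impI)
  show "displacement i \<sigma> \<in> iter_kernel i" if "i \<in> I" for i
    using displacement(1)[OF \<sigma> that] .
  fix i j assume ij: "i \<in> I" "j \<in> I" "i \<le> j"
  have "I \<noteq> {}" "tower j \<in> tower_field I"
    using ij(2) tower_in_preimages preimages_subset_tower_field by blast+
  then have "\<sigma> (ev (iterate_poly f (j - i)) (tower j)) = ev (iterate_poly f (j - i)) (\<sigma> (tower j))"
    using tower_gal_ev[OF \<sigma>] by blast
  then have "\<sigma> (tower i) = tower i + const_omega ((poly f ^^ (j - i)) (displacement j \<sigma>))"
    using funpow_tower[OF ij(3)] displacement(2)[OF \<sigma> ij(2)]
    by (simp add: ev_pow.add funpow_ev_const_omega)
  then show "(poly f ^^ (j - i)) (displacement j \<sigma>) = displacement i \<sigma>"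
    using displacementI by simp
qed

lemma displacement_inj:
  assumes \<sigma>: "\<sigma> \<in> carrier (tower_gal I)" and \<tau>: "\<tau> \<in> carrier (tower_gal I)"
    and eq: "\<And>i. i \<in> I \<Longrightarrow> displacement i \<sigma> = displacement i \<tau>"
  shows "\<sigma> = \<tau>"
proof (rule extensionalityI[OF gal_groupD(2)[OF \<sigma>] gal_groupD(2)[OF \<tau>]])
  fix x assume "x \<in> tower_field I"
  then obtain i where i: "i \<in> I" "x \<in> splitting f i"
    unfolding tower_field_def by blast
  have "\<sigma> (tower i) = \<tau> (tower i)"
    using displacement(2)[OF \<sigma> i(1)] displacement(2)[OF \<tau> i(1)] eq[OF i(1)] by simp
  then show "\<sigma> x = \<tau> x"
    using tower_gal_determined[OF \<sigma> \<tau> i(1) tower_in_preimages _ i(2)] by blast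
qed

lemma displacement_surj:
  assumes w: "coherent I w" and I: "I \<noteq> {}"
  obtains \<sigma> where "\<sigma> \<in> carrier (tower_gal I)" "\<And>i. i \<in> I \<Longrightarrow> displacement i \<sigma> = w i"
proof (rule that[OF translate_aut_in_gal_group[OF w I]])
  fix i assume i: "i \<in> I"
  have "tower i \<in> tower_field I"
    using tower_in_preimages preimages_subset_tower_field[OF i] by blast
  then show "displacement i (restrict (translate_aut I w) (tower_field I)) = w i"
    using translate_aut_tower[OF w i] by (intro displacementI) simp
qed

end

section \<open>Coordinates on the iterated kernels\<close>

lemma carrier_Zmod_power: "p > 0 \<Longrightarrow> carrier (Zmod_power p d) = ({..<d} \<rightarrow>\<^sub>E {0..<int p})"
  by (simp add: Zmod_power_def carrier_integer_mod_group)

lemma group_Zmod_power: "group (Zmod_power p d)"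
  by (simp add: Zmod_power_def)

lemma card_Zmod_power: "p > 0 \<Longrightarrow> card (carrier (Zmod_power p d)) = p ^ d"
  by (simp add: carrier_Zmod_power card_PiE)

lemma mult_Zmod_power: "i < d \<Longrightarrow> (x \<otimes>\<^bsub>Zmod_power p d\<^esub> y) i = (x i + y i) mod int p"
  by (simp add: Zmod_power_def)

lemma sum_lessThan_add:
  "(\<Sum>i<a + b. g i) = (\<Sum>i<a. g i) + (\<Sum>j<b. g (a + j :: nat) :: 'a::comm_monoid_add)"
  by (induction b) (simp_all add: add.assoc)

definition comb :: "(nat \<Rightarrow> 'a::ring_1) \<Rightarrow> nat \<Rightarrow> (nat \<Rightarrow> int) \<Rightarrow> 'a" where
  "comb e d x = (\<Sum>i<d. of_int (x i) * e i)"

lemma comb_cong: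
  "(\<And>i. i < d \<Longrightarrow> e i = e' i) \<Longrightarrow> (\<And>i. i < d \<Longrightarrow> x i = x' i) \<Longrightarrow> comb e d x = comb e' d x'"
  unfolding comb_def by (intro sum.cong) simp_all

text \<open>Reduction of the coordinates modulo the characteristic disappears under
  \<open>of_int\<close>.\<close>

lemma comb_mult:
  "comb e d (x \<otimes>\<^bsub>Zmod_power CHAR('a) d\<^esub> y) = comb e d x + comb e d (y :: nat \<Rightarrow> int)"
  for e :: "nat \<Rightarrow> 'a::ring_1"
proof -
  have "of_int ((x \<otimes>\<^bsub>Zmod_power CHAR('a) d\<^esub> y) i) * e i = of_int (x i) * e i + of_int (y i) * e i"
    if "i < d" for i
    by (simp only: mult_Zmod_power[OF that] of_int_mod_CHAR of_int_add distrib_right)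
  then show ?thesis
    unfolding comb_def sum.distrib[symmetric] by (intro sum.cong) simp_all
qed

text \<open>A Bezout relation with the prime characteristic gives the inverse as an integer, so that
  it can act on integer coordinates.\<close>

lemma of_int_unit_CHAR:
  fixes x :: int
  assumes "of_int x \<noteq> (0 :: 'a::field)" and "CHAR('a) > 0"
  obtains u :: int where "of_int u * of_int x = (1 :: 'a)"
proof -
  have "Factorial_Ring.prime (int CHAR('a))"
    using prime_CHAR_semidom[OF assms(2)] by simp
  moreover have "\<not> int CHAR('a) dvd x"
    using assms(1) by (simp add: of_int_eq_0_iff_char_dvd)
  ultimately have "coprime (int CHAR('a)) x"
    by (rule prime_imp_coprime)
  then obtain u where "[x * u = 1] (mod int CHAR('a))"
    using cong_solve_coprime_int coprime_commute by blast
  then have "of_int (x * u) = (of_int 1 :: 'a)"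
    by (simp only: of_int_eq_iff_cong_CHAR)
  then show thesis
    by (intro that[of u]) (simp add: mult.commute)
qed

lemma eq_if_of_int_eq:
  fixes x y :: int
  assumes "of_int x = (of_int y :: 'a::ring_1)" and "x \<in> {0..<int CHAR('a)}" "y \<in> {0..<int CHAR('a)}"
  shows "x = y"
  using assms by (auto simp: of_int_eq_iff_cong_CHAR Cong.cong_def)

text \<open>Injectivity of \<open>comb\<close> on reduced coordinates encodes linear independence
  over the prime field, which survives adding a vector outside the span.\<close>

lemma comb_inj_extend:
  fixes b :: "nat \<Rightarrow> 'a::field"
  assumes char: "CHAR('a) > 0"
    and inj: "inj_on (comb b d) (carrier (Zmod_power CHAR('a) d))"
    and c: "c \<notin> comb b d ` carrier (Zmod_power CHAR('a) d)"
  shows "inj_on (comb (b(d := c)) (Suc d)) (carrier (Zmod_power CHAR('a) (Suc d)))"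
proof (rule inj_onI)
  let ?p = "CHAR('a)"
  fix x y
  assume x: "x \<in> carrier (Zmod_power ?p (Suc d))" and y: "y \<in> carrier (Zmod_power ?p (Suc d))"
    and eq: "comb (b(d := c)) (Suc d) x = comb (b(d := c)) (Suc d) y"
  have split: "comb (b(d := c)) (Suc d) z = comb b d z + of_int (z d) * c" for z
    by (simp add: comb_def)
  have diff: "of_int (y d - x d) * c = comb b d x - comb b d y"
    using eq by (simp add: split algebra_simps)
  have last: "of_int (x d) = (of_int (y d) :: 'a)"
  proof (rule ccontr)
    assume "of_int (x d) \<noteq> (of_int (y d) :: 'a)"
    then have "of_int (y d - x d) \<noteq> (0 :: 'a)" by simp
    then obtain u where u: "of_int u * of_int (y d - x d) = (1 :: 'a)"
      by (rule of_int_unit_CHAR[OF _ char])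
    \<comment> \<open>If the last coordinates differed, \<open>c\<close> would be the combination
      with these coordinates: the difference of the initial parts divided by
      \<open>y d - x d\<close>.\<close>
    define z where "z = (\<lambda>i\<in>{..<d}. (u * (x i - y i)) mod int ?p)"
    have summand: "of_int (z i) * b i = of_int u * (of_int (x i) * b i - of_int (y i) * b i)"
      if "i < d" for i
    proof -
      have z: "of_int (z i) = of_int u * (of_int (x i) - of_int (y i) :: 'a)"
        using that
        by (simp only: z_def restrict_apply' lessThan_iff of_int_mod_CHAR of_int_mult of_int_diff)
      show ?thesis
        unfolding z by (simp add: algebra_simps)
    qed
    have "comb b d z = of_int u * (comb b d x - comb b d y)"
      unfolding comb_def sum_subtractf[symmetric] sum_distrib_left
      by (intro sum.cong refl summand) simp
    also have "\<dots> = c"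
      unfolding diff[symmetric] mult.assoc[symmetric] u by simp
    finally have "c = comb b d z" ..
    moreover have "z \<in> carrier (Zmod_power ?p d)"
      using char by (simp add: z_def carrier_Zmod_power)
    ultimately show False
      using c by blast
  qed
  \<comment> \<open>Truncation restores the extensionality demanded by the carrier of
    \<open>Zmod_power\<close>.\<close>
  have le: "comb b d (restrict x {..<d}) = comb b d (restrict y {..<d})"
  proof -
    have "comb b d x = comb b d y"
      using diff last by simp
    then show ?thesis
      by (simp add: comb_def)
  qed
  have "restrict x {..<d} = restrict y {..<d}"
    using x y by (intro inj_onD[OF inj, OF le]) (auto simp: carrier_Zmod_power[OF char] PiE_iff)
  then have init: "x i = y i" if "i < d" for i
    using that by (metis lessThan_iff restrict_apply')
  have "x d = y d"
    using x y by (intro eq_if_of_int_eq[OF last]) (auto simp: carrier_Zmod_power[OF char] PiE_iff)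
  with init have "x i = y i" if "i \<in> {..<Suc d}" for i
    using that by (auto simp: less_Suc_eq)
  then show "x = y"
    by (rule PiE_ext[OF x[unfolded carrier_Zmod_power[OF char]] y[unfolded carrier_Zmod_power[OF char]]])
qed

text \<open>Greedy choice: fewer than \<open>m\<close> independent vectors span fewer elements than
  \<open>A\<close> has, which leaves a vector to add. At \<open>m\<close> vectors the count forces
  the span to be all of \<open>A\<close>.\<close>

lemma ex_prime_field_basis:
  fixes A :: "'a::field set"
  assumes char: "CHAR('a) > 0" and card: "card A = CHAR('a) ^ m"
    and zero: "0 \<in> A" and add: "\<And>x y. x \<in> A \<Longrightarrow> y \<in> A \<Longrightarrow> x + y \<in> A"
    and scale: "\<And>x n. x \<in> A \<Longrightarrow> of_int n * x \<in> A"
  obtains b where "\<And>i. i < m \<Longrightarrow> b i \<in> A"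
    and "bij_betw (comb b m) (carrier (Zmod_power CHAR('a) m)) A"
proof -
  let ?p = "CHAR('a)"
  have A: "finite A"
    using card char by (intro card_ge_0_finite) simp
  have into: "comb b d ` carrier (Zmod_power ?p d) \<subseteq> A" if b: "\<And>i. i < d \<Longrightarrow> b i \<in> A" for b d
  proof (rule image_subsetI)
    fix x
    show "comb b d x \<in> A"
      using b by (induction d) (simp_all add: comb_def zero add scale)
  qed
  have "\<exists>b. (\<forall>i<d. b i \<in> A) \<and> inj_on (comb b d) (carrier (Zmod_power ?p d))" if "d \<le> m" for d
    using that
  proof (induction d)
    case 0
    show ?case
      by (simp add: carrier_Zmod_power[OF char])
  next
    case (Suc d)
    then obtain b where b: "\<forall>i<d. b i \<in> A" and inj: "inj_on (comb b d) (carrier (Zmod_power ?p d))"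
      by auto
    have "1 < ?p"
      using prime_CHAR_semidom[OF char] by (rule prime_gt_1_nat)
    then have "?p ^ d < ?p ^ m"
      using Suc.prems by (intro power_strict_increasing) simp_all
    then have "card (comb b d ` carrier (Zmod_power ?p d)) < card A"
      using card_image[OF inj] card by (simp add: card_Zmod_power[OF char])
    then have "comb b d ` carrier (Zmod_power ?p d) \<noteq> A"
      by blast
    then obtain c where c: "c \<in> A" "c \<notin> comb b d ` carrier (Zmod_power ?p d)"
      using into[of d b] b by blast
    have "\<forall>i<Suc d. (b(d := c)) i \<in> A"
      using b c(1) by (simp add: less_Suc_eq)
    then show ?case
      using comb_inj_extend[OF char inj c(2)] by blast
  qed
  then obtain b where b: "\<forall>i<m. b i \<in> A" and inj: "inj_on (comb b m) (carrier (Zmod_power ?p m))"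
    by blast
  have "comb b m ` carrier (Zmod_power ?p m) = A"
    using into[of m b] b card card_image[OF inj]
    by (intro card_subset_eq[OF A]) (simp_all add: card_Zmod_power[OF char])
  then show thesis
    using b inj by (intro that[of b]) (simp_all add: bij_betw_def)
qed

section \<open>Compatible bases of the iterated kernels\<close>

context separable_additive
begin

lemma iter_kernel_Suc: "w \<in> iter_kernel (Suc n) \<longleftrightarrow> poly f w \<in> iter_kernel n"
  by (simp add: iter_kernel_def funpow_Suc_right del: funpow.simps)

lemma additive_poly_comb: "poly f (comb e d x) = comb (\<lambda>i. poly f (e i)) d x"
  unfolding comb_def additive_of_int_mult[OF additive_poly_f, symmetric]
  by (rule Modules.additive.sum[OF additive_poly_f])

primrec lift :: "'k \<Rightarrow> nat \<Rightarrow> 'k" where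
  "lift c 0 = c"
| "lift c (Suc r) = (SOME y. poly f y = lift c r)"

lemma poly_lift: "poly f (lift c (Suc r)) = lift c r"
proof -
  have "\<exists>y. poly f y = lift c r"
    using degree_pos by (metis poly_surj_alg_closed)
  then show ?thesis
    unfolding lift.simps by (rule someI_ex)
qed

definition kernel_basis :: "nat \<Rightarrow> 'k" where
  "kernel_basis = (SOME b. (\<forall>i<m. b i \<in> iter_kernel 1)
     \<and> bij_betw (comb b m) (carrier (Zmod_power CHAR('k) m)) (iter_kernel 1))"

lemma kernel_basis:
  shows "i < m \<Longrightarrow> poly f (kernel_basis i) = 0"
    and "bij_betw (comb kernel_basis m) (carrier (Zmod_power CHAR('k) m)) (iter_kernel 1)"
proof -
  have W: "iter_kernel 1 = {w. poly f w = 0}"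
    by (simp add: iter_kernel_def)
  have card: "card (iter_kernel 1) = CHAR('k) ^ m"
    unfolding W card_roots_rsquarefree[OF rsquarefree] by (rule degree)
  have "\<exists>b. (\<forall>i<m. b i \<in> iter_kernel 1)
      \<and> bij_betw (comb b m) (carrier (Zmod_power CHAR('k) m)) (iter_kernel 1)"
  proof (rule ex_prime_field_basis[OF char_pos card])
    show "0 \<in> iter_kernel 1"
      unfolding W by (simp add: Modules.additive.zero[OF additive_poly_f])
    show "x + y \<in> iter_kernel 1" if "x \<in> iter_kernel 1" "y \<in> iter_kernel 1" for x y
      using that unfolding W by (simp add: Modules.additive.add[OF additive_poly_f])
    show "of_int n * x \<in> iter_kernel 1" if "x \<in> iter_kernel 1" for n x
      using that unfolding W by (simp add: additive_of_int_mult[OF additive_poly_f])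
  qed blast
  from someI_ex[OF this, folded kernel_basis_def]
  show "i < m \<Longrightarrow> poly f (kernel_basis i) = 0"
    and "bij_betw (comb kernel_basis m) (carrier (Zmod_power CHAR('k) m)) (iter_kernel 1)"
    unfolding W by blast+
qed

text \<open>Position \<open>i = m q + r\<close> carries a preimage of the \<open>r\<close>-th basis vector of \<open>ker f\<close> under
  \<open>f ^^ (n - 1 - q)\<close>, so that \<open>f\<close> maps the level \<open>n + 1\<close> frame to the level \<open>n\<close> frame and kills the
  last block of \<open>m\<close> vectors.\<close>

definition frame :: "nat \<Rightarrow> nat \<Rightarrow> 'k" where
  "frame n i = lift (kernel_basis (i mod m)) (n - Suc (i div m))"

lemma frame_Suc: "i < m * n \<Longrightarrow> poly f (frame (Suc n) i) = frame n i"
proof -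
  assume "i < m * n"
  \<comment> \<open>The bound keeps the truncated subtraction in \<open>frame\<close> exact, so
    passing to \<open>Suc n\<close> adds precisely one lift.\<close>
  then have "i div m < n"
    by (simp add: less_mult_imp_div_less mult.commute)
  then have "Suc n - Suc (i div m) = Suc (n - Suc (i div m))"
    by simp
  then show ?thesis
    unfolding frame_def by (simp only: poly_lift)
qed

text \<open>In the last block the quotient by \<open>m\<close> is \<open>n\<close>, so the lifting
  height is 0.\<close>

lemma frame_last: "j < m \<Longrightarrow> frame (Suc n) (m * n + j) = kernel_basis j"
  by (simp add: frame_def)

definition kernel_param :: "nat \<Rightarrow> (nat \<Rightarrow> int) \<Rightarrow> 'k" where
  "kernel_param n = comb (frame n) (m * n)"

lemma kernel_param_Suc:
  "kernel_param (Suc n) x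
    = comb (frame (Suc n)) (m * n) x + comb kernel_basis m (\<lambda>j. x (m * n + j))"
proof -
  have "comb (frame (Suc n)) (m * n + m) x
      = comb (frame (Suc n)) (m * n) x + (\<Sum>j<m. of_int (x (m * n + j)) * frame (Suc n) (m * n + j))"
    unfolding comb_def by (rule sum_lessThan_add)
  also have "(\<Sum>j<m. of_int (x (m * n + j)) * frame (Suc n) (m * n + j))
      = comb kernel_basis m (\<lambda>j. x (m * n + j))"
    unfolding comb_def by (intro sum.cong) (simp_all add: frame_last)
  finally show ?thesis
    by (simp add: kernel_param_def add.commute)
qed

lemma kernel_param_restrict: "kernel_param n (first_coords (m * n) x) = kernel_param n x"
  unfolding kernel_param_def first_coords_def by (intro comb_cong) simp_all

text \<open>\<open>f\<close> lowers the first \<open>m * n\<close> frame vectors by one level and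
  kills the last block. Applying \<open>f\<close> thus corresponds to dropping the last
  \<open>m\<close> coordinates.\<close>

lemma poly_kernel_param: "poly f (kernel_param (Suc n) x) = kernel_param n x"
proof -
  have "poly f (comb kernel_basis m y) = 0" for y
    unfolding additive_poly_comb unfolding comb_def by (intro sum.neutral) (simp add: kernel_basis(1))
  moreover have "poly f (comb (frame (Suc n)) (m * n) x) = kernel_param n x"
    unfolding additive_poly_comb kernel_param_def by (intro comb_cong frame_Suc refl)
  ultimately show ?thesis
    unfolding kernel_param_Suc Modules.additive.add[OF additive_poly_f] by simp
qed

lemma funpow_kernel_param: "(poly f ^^ k) (kernel_param (i + k) x) = kernel_param i x"
proof (induction k)
  case (Suc k)
  then show ?case
    by (simp add: funpow_Suc_right poly_kernel_param del: funpow.simps)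
qed simp

lemma kernel_param_mult:
  "kernel_param n (x \<otimes>\<^bsub>Zmod_power CHAR('k) (m * n)\<^esub> y) = kernel_param n x + kernel_param n y"
  unfolding kernel_param_def by (rule comb_mult)

lemma first_coords_carrier:
  assumes "d \<le> e" "x \<in> carrier (Zmod_power CHAR('k) e)"
  shows "first_coords d x \<in> carrier (Zmod_power CHAR('k) d)"
  using assms by (auto simp: first_coords_def carrier_Zmod_power[OF char_pos] PiE_iff)

text \<open>Induction along the exact sequence formed by \<open>iter_kernel 1\<close>,
  \<open>iter_kernel (Suc n)\<close> and \<open>iter_kernel n\<close>: the first
  \<open>m * n\<close> coordinates describe the image under \<open>f\<close>, the last
  \<open>m\<close> the part in the kernel of \<open>f\<close>.\<close>

lemma bij_kernel_param:
  "bij_betw (kernel_param n) (carrier (Zmod_power CHAR('k) (m * n))) (iter_kernel n)"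
proof (induction n)
  case 0
  show ?case
    by (simp add: carrier_Zmod_power[OF char_pos] kernel_param_def comb_def iter_kernel_def bij_betw_def)
next
  case (Suc n)
  let ?C = "\<lambda>d. carrier (Zmod_power CHAR('k) d)"
  note C = carrier_Zmod_power[OF char_pos]
  have le: "m * n \<le> m * Suc n" by simp
  have block: "(\<lambda>j\<in>{..<m}. x (m * n + j)) \<in> ?C m" if "x \<in> ?C (m * Suc n)" for x
    using that by (auto simp: C PiE_iff)
  have comb_block: "comb kernel_basis m (\<lambda>j\<in>{..<m}. x (m * n + j))
      = comb kernel_basis m (\<lambda>j. x (m * n + j))" for x
    by (intro comb_cong) simp_all
  show ?case
  proof (rule bij_betw_imageI)
    show "inj_on (kernel_param (Suc n)) (?C (m * Suc n))"
    proof (rule inj_onI)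
      fix x y assume x: "x \<in> ?C (m * Suc n)" and y: "y \<in> ?C (m * Suc n)"
        and eq: "kernel_param (Suc n) x = kernel_param (Suc n) y"
      \<comment> \<open>Applying \<open>f\<close> isolates the first \<open>m * n\<close>
        coordinates; once they agree, the basis of the kernel of \<open>f\<close> settles the last
        block.\<close>
      have "kernel_param n x = kernel_param n y"
        using arg_cong[OF eq, of "poly f"] by (simp only: poly_kernel_param)
      then have "first_coords (m * n) x = first_coords (m * n) y"
        using first_coords_carrier[OF le x] first_coords_carrier[OF le y]
        by (intro inj_onD[OF bij_betw_imp_inj_on[OF Suc.IH]]) (simp_all only: kernel_param_restrict)
      then have init: "x i = y i" if "i < m * n" for i
        using that unfolding first_coords_def by (metis lessThan_iff restrict_apply')
      then have "comb (frame (Suc n)) (m * n) x = comb (frame (Suc n)) (m * n) y"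
        by (intro comb_cong) simp_all
      then have "comb kernel_basis m (\<lambda>j. x (m * n + j)) = comb kernel_basis m (\<lambda>j. y (m * n + j))"
        using eq unfolding kernel_param_Suc by simp
      then have "(\<lambda>j\<in>{..<m}. x (m * n + j)) = (\<lambda>j\<in>{..<m}. y (m * n + j))"
        using block[OF x] block[OF y]
        by (intro inj_onD[OF bij_betw_imp_inj_on[OF kernel_basis(2)]]) (simp_all only: comb_block)
      then have last: "x (m * n + j) = y (m * n + j)" if "j < m" for j
        using that by (metis (no_types, lifting) lessThan_iff restrict_apply')
      have "x i = y i" if "i \<in> {..<m * Suc n}" for i
      proof (cases "i < m * n")
        case False
        then have "i = m * n + (i - m * n)" "i - m * n < m"
          using that by auto
        then show ?thesis
          using last by metis
      qed (rule init)
      then show "x = y"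
        using x y PiE_ext unfolding C by blast
    qed
    show "kernel_param (Suc n) ` ?C (m * Suc n) = iter_kernel (Suc n)"
    proof (intro subset_antisym subsetI)
      fix w assume "w \<in> kernel_param (Suc n) ` ?C (m * Suc n)"
      then obtain x where x: "x \<in> ?C (m * Suc n)" "w = kernel_param (Suc n) x" by blast
      have "poly f w = kernel_param n (first_coords (m * n) x)"
        unfolding x(2) kernel_param_restrict poly_kernel_param ..
      then show "w \<in> iter_kernel (Suc n)"
        unfolding iter_kernel_Suc
        using bij_betw_apply[OF Suc.IH first_coords_carrier[OF le x(1)]] by simp
    next
      fix w assume "w \<in> iter_kernel (Suc n)"
      then have "poly f w \<in> kernel_param n ` ?C (m * n)"
        unfolding iter_kernel_Suc bij_betw_imp_surj_on[OF Suc.IH] .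
      then obtain x where x: "x \<in> ?C (m * n)" "poly f w = kernel_param n x" by blast
      \<comment> \<open>\<open>v\<close> lifts \<open>poly f w\<close> by using the same coordinates
        one level up, so \<open>w - v\<close> is killed by \<open>f\<close>.\<close>
      define v where "v = comb (frame (Suc n)) (m * n) x"
      have "poly f v = kernel_param n x"
        unfolding v_def additive_poly_comb kernel_param_def by (intro comb_cong frame_Suc refl)
      then have "w - v \<in> iter_kernel 1"
        using x(2) by (simp add: iter_kernel_def Modules.additive.diff[OF additive_poly_f])
      then obtain z where z: "z \<in> ?C m" "w - v = comb kernel_basis m z"
        using bij_betw_imp_surj_on[OF kernel_basis(2)] by blast
      \<comment> \<open>The coordinates of \<open>v\<close> followed by those of
        \<open>w - v\<close>.\<close>
      define y where "y = (\<lambda>i\<in>{..<m * Suc n}. if i < m * n then x i else z (i - m * n))"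
      have y: "y \<in> ?C (m * Suc n)"
        using x(1) z(1) by (auto simp: y_def C PiE_iff)
      have "comb (frame (Suc n)) (m * n) y = v"
        unfolding v_def by (intro comb_cong) (simp_all add: y_def)
      moreover have "comb kernel_basis m (\<lambda>j. y (m * n + j)) = w - v"
        unfolding z(2) by (intro comb_cong) (simp_all add: y_def)
      ultimately have "kernel_param (Suc n) y = w"
        unfolding kernel_param_Suc by simp
      then show "w \<in> kernel_param (Suc n) ` ?C (m * Suc n)"
        using y by blast
    qed
  qed
qed

end

section \<open>Monodromy groups and the Krull topology\<close>

text \<open>On the space \<open>h\<close> is a function of \<open>g\<close>, and every set of values
  of \<open>g\<close> is open. Continuity in either direction below reduces to dependence on a
  single coordinate.\<close>

lemma continuous_map_discrete_factor:
  assumes g: "continuous_map T (discrete_topology U) g" and h: "\<And>x. x \<in> topspace T \<Longrightarrow> h x \<in> V"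
    and factor: "\<And>x y. x \<in> topspace T \<Longrightarrow> y \<in> topspace T \<Longrightarrow> g x = g y \<Longrightarrow> h x = h y"
  shows "continuous_map T (discrete_topology V) h"
  unfolding continuous_map_def
proof (intro conjI allI impI)
  show "h \<in> topspace T \<rightarrow> topspace (discrete_topology V)"
    using h by simp
  fix W assume "openin (discrete_topology V) W"
  let ?S = "g ` {x \<in> topspace T. h x \<in> W}"
  have "{x \<in> topspace T. h x \<in> W} = {x \<in> topspace T. g x \<in> ?S}"
  proof (intro Collect_cong conj_cong refl iffI)
    fix x assume x: "x \<in> topspace T"
    show "g x \<in> ?S" if "h x \<in> W"
      using x that by blast
    assume "g x \<in> ?S"
    then obtain y where y: "y \<in> topspace T" "g x = g y" "h y \<in> W" by blast
    show "h x \<in> W"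
      unfolding factor[OF x y(1,2)] by (rule y(3))
  qed
  moreover have "?S \<subseteq> U"
    using continuous_map_image_subset_topspace[OF g] by auto
  then have "openin T {x \<in> topspace T. g x \<in> ?S}"
    by (intro openin_continuous_map_preimage[OF g]) simp
  ultimately show "openin T {x \<in> topspace T. h x \<in> W}"
    by simp
qed

text \<open>Galois automorphisms are extensional and map \<open>L\<close> into itself, so
  intersecting with the product space loses none of them.\<close>

lemma topspace_krull_topology: "topspace (krull_topology L K) = carrier (gal_group L K)"
proof -
  have "carrier (gal_group L K) \<subseteq> (\<Pi>\<^sub>E x\<in>L. L)"
  proof
    fix \<sigma> assume \<sigma>: "\<sigma> \<in> carrier (gal_group L K)"
    show "\<sigma> \<in> (\<Pi>\<^sub>E x\<in>L. L)"
      unfolding PiE_iff using gal_groupD(2)[OF \<sigma>] gal_groupD(4)[OF \<sigma>] by blast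
  qed
  then show ?thesis
    by (simp add: krull_topology_def Int_absorb1)
qed

lemma topspace_inverse_limit_topology:
  "topspace (inverse_limit_topology I G \<pi>) = carrier (inverse_limit I G \<pi>)"
  by (auto simp: inverse_limit_topology_def inverse_limit_def)

lemma continuous_map_krull_coordinate:
  assumes "x \<in> L"
  shows "continuous_map (krull_topology L K) (discrete_topology L) (\<lambda>\<sigma>. \<sigma> x)"
  unfolding krull_topology_def
  by (intro continuous_map_from_subtopology continuous_map_product_projection[OF assms])

lemma continuous_map_inverse_limit_coordinate:
  assumes "i \<in> I"
  shows "continuous_map (inverse_limit_topology I G \<pi>) (discrete_topology (carrier (G i))) (\<lambda>s. s i)"
  unfolding inverse_limit_topology_def
  by (intro continuous_map_from_subtopology continuous_map_product_projection[OF assms])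

lemma inverse_limit_mult [simp]:
  "s \<otimes>\<^bsub>inverse_limit I G \<pi>\<^esub> s' = (\<lambda>i\<in>I. s i \<otimes>\<^bsub>G i\<^esub> s' i)"
  by (simp add: inverse_limit_def)

lemma inverse_limit_carrier:
  "s \<in> carrier (inverse_limit I G \<pi>) \<longleftrightarrow>
     s \<in> (\<Pi>\<^sub>E i\<in>I. carrier (G i)) \<and> (\<forall>i\<in>I. \<forall>j\<in>I. i \<le> j \<longrightarrow> \<pi> i j (s j) = s i)"
  by (simp add: inverse_limit_def)

abbreviation (input) coord_limit :: "nat \<Rightarrow> nat \<Rightarrow> nat set \<Rightarrow> (nat \<Rightarrow> nat \<Rightarrow> int) monoid" where
  "coord_limit p m I \<equiv> inverse_limit I (\<lambda>n. Zmod_power p (m * n)) (\<lambda>i j. first_coords (m * i))"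

section \<open>Coordinates of automorphisms and the isomorphism with the inverse limit\<close>

context separable_additive
begin

definition coords :: "nat \<Rightarrow> ('k omega \<Rightarrow> 'k omega) \<Rightarrow> nat \<Rightarrow> int" where
  "coords n \<sigma> = inv_into (carrier (Zmod_power CHAR('k) (m * n))) (kernel_param n) (displacement n \<sigma>)"

lemma coords:
  assumes "\<sigma> \<in> carrier (tower_gal I)" "n \<in> I"
  shows "coords n \<sigma> \<in> carrier (Zmod_power CHAR('k) (m * n))"
    and "kernel_param n (coords n \<sigma>) = displacement n \<sigma>"
proof -
  have "displacement n \<sigma> \<in> kernel_param n ` carrier (Zmod_power CHAR('k) (m * n))"
    using displacement(1)[OF assms] bij_betw_imp_surj_on[OF bij_kernel_param] by simp
  then show "coords n \<sigma> \<in> carrier (Zmod_power CHAR('k) (m * n))"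
    "kernel_param n (coords n \<sigma>) = displacement n \<sigma>"
    unfolding coords_def by (rule inv_into_into, rule f_inv_into_f)
qed

lemma coordsI:
  assumes "x \<in> carrier (Zmod_power CHAR('k) (m * n))" and "kernel_param n x = displacement n \<sigma>"
  shows "coords n \<sigma> = x"
  unfolding coords_def assms(2)[symmetric]
  by (rule inv_into_f_f[OF bij_betw_imp_inj_on[OF bij_kernel_param] assms(1)])

lemma coords_mult:
  assumes \<sigma>: "\<sigma> \<in> carrier (tower_gal I)" and \<tau>: "\<tau> \<in> carrier (tower_gal I)" and n: "n \<in> I"
  shows "coords n (\<sigma> \<otimes>\<^bsub>tower_gal I\<^esub> \<tau>)
    = coords n \<sigma> \<otimes>\<^bsub>Zmod_power CHAR('k) (m * n)\<^esub> coords n \<tau>"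
proof (rule coordsI)
  interpret Z: group "Zmod_power CHAR('k) (m * n)"
    by (rule group_Zmod_power)
  show "coords n \<sigma> \<otimes>\<^bsub>Zmod_power CHAR('k) (m * n)\<^esub> coords n \<tau> \<in> carrier (Zmod_power CHAR('k) (m * n))"
    using coords(1)[OF \<sigma> n] coords(1)[OF \<tau> n] by (rule Z.m_closed)
  show "kernel_param n (coords n \<sigma> \<otimes>\<^bsub>Zmod_power CHAR('k) (m * n)\<^esub> coords n \<tau>)
      = displacement n (\<sigma> \<otimes>\<^bsub>tower_gal I\<^esub> \<tau>)"
    unfolding kernel_param_mult coords(2)[OF \<sigma> n] coords(2)[OF \<tau> n] displacement_mult[OF \<sigma> \<tau> n] ..
qed

lemma coords_inj:
  assumes \<sigma>: "\<sigma> \<in> carrier (tower_gal I)" and \<tau>: "\<tau> \<in> carrier (tower_gal I)"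
    and eq: "\<And>n. n \<in> I \<Longrightarrow> coords n \<sigma> = coords n \<tau>"
  shows "\<sigma> = \<tau>"
proof (rule displacement_inj[OF \<sigma> \<tau>])
  fix n assume n: "n \<in> I"
  show "displacement n \<sigma> = displacement n \<tau>"
    unfolding coords(2)[OF \<sigma> n, symmetric] coords(2)[OF \<tau> n, symmetric] eq[OF n] ..
qed

text \<open>Iterating \<open>f\<close> carries the displacement at level \<open>j\<close> to the one
  at level \<open>i\<close>, and in coordinates this iteration is truncation.\<close>

lemma first_coords_coords:
  assumes \<sigma>: "\<sigma> \<in> carrier (tower_gal I)" and ij: "i \<in> I" "j \<in> I" "i \<le> j"
  shows "first_coords (m * i) (coords j \<sigma>) = coords i \<sigma>"
proof (rule coordsI[symmetric])
  show "first_coords (m * i) (coords j \<sigma>) \<in> carrier (Zmod_power CHAR('k) (m * i))"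
    using coords(1)[OF \<sigma> ij(2)] ij(3) by (intro first_coords_carrier[of _ "m * j"]) simp_all
  have "kernel_param i (coords j \<sigma>) = (poly f ^^ (j - i)) (kernel_param j (coords j \<sigma>))"
    using funpow_kernel_param[of "j - i" i] ij(3) by simp
  then show "kernel_param i (first_coords (m * i) (coords j \<sigma>)) = displacement i \<sigma>"
    unfolding kernel_param_restrict coords(2)[OF \<sigma> ij(2)]
    using coherentD(2)[OF coherent_displacement[OF \<sigma>] ij] by (rule trans)
qed

lemma coords_in_limit:
  assumes \<sigma>: "\<sigma> \<in> carrier (tower_gal I)"
  shows "(\<lambda>n\<in>I. coords n \<sigma>) \<in> carrier (coord_limit CHAR('k) m I)"
  unfolding inverse_limit_carrier using coords(1)[OF \<sigma>] first_coords_coords[OF \<sigma>] by simp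

text \<open>The kernel elements with coordinates \<open>s n\<close> form a coherent family, which a
  translation automorphism realizes.\<close>

lemma coords_surj:
  assumes s: "s \<in> carrier (coord_limit CHAR('k) m I)" and I: "I \<noteq> {}"
  obtains \<sigma> where "\<sigma> \<in> carrier (tower_gal I)" "\<And>n. n \<in> I \<Longrightarrow> coords n \<sigma> = s n"
proof -
  have carr: "s n \<in> carrier (Zmod_power CHAR('k) (m * n))" if "n \<in> I" for n
    using s that unfolding inverse_limit_carrier by (auto simp: PiE_iff)
  have comp: "first_coords (m * i) (s j) = s i" if "i \<in> I" "j \<in> I" "i \<le> j" for i j
    using s that unfolding inverse_limit_carrier by blast
  have "coherent I (\<lambda>n. kernel_param n (s n))"
    unfolding coherent_def
  proof (intro conjI ballI impI)
    show "kernel_param n (s n) \<in> iter_kernel n" if "n \<in> I" for n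
      using bij_betw_apply[OF bij_kernel_param carr[OF that]] .
    fix i j assume ij: "i \<in> I" "j \<in> I" "i \<le> j"
    have "(poly f ^^ (j - i)) (kernel_param j (s j)) = kernel_param i (s j)"
      using funpow_kernel_param[of "j - i" i] ij(3) by simp
    also have "\<dots> = kernel_param i (s i)"
      using kernel_param_restrict[of i "s j"] unfolding comp[OF ij] by (rule sym)
    finally show "(poly f ^^ (j - i)) (kernel_param j (s j)) = kernel_param i (s i)" .
  qed
  then obtain \<sigma> where \<sigma>: "\<sigma> \<in> carrier (tower_gal I)"
    and d: "\<And>n. n \<in> I \<Longrightarrow> displacement n \<sigma> = kernel_param n (s n)"
    by (rule displacement_surj[OF _ I]) blast
  have "coords n \<sigma> = s n" if "n \<in> I" for n
    by (rule coordsI[OF carr[OF that] d[OF that, symmetric]])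
  with \<sigma> show thesis
    by (rule that)
qed

lemma iso_coord_limit:
  assumes I: "I \<noteq> {}"
  shows "(\<lambda>\<sigma>. \<lambda>n\<in>I. coords n \<sigma>) \<in> iso (tower_gal I) (coord_limit CHAR('k) m I)"
  unfolding iso_iff
proof (intro conjI)
  let ?\<phi> = "\<lambda>\<sigma>. \<lambda>n\<in>I. coords n \<sigma>"
  show "?\<phi> \<in> hom (tower_gal I) (coord_limit CHAR('k) m I)"
  proof (rule homI)
    show "?\<phi> \<sigma> \<in> carrier (coord_limit CHAR('k) m I)" if "\<sigma> \<in> carrier (tower_gal I)" for \<sigma>
      using that by (rule coords_in_limit)
    show "?\<phi> (\<sigma> \<otimes>\<^bsub>tower_gal I\<^esub> \<tau>) = ?\<phi> \<sigma> \<otimes>\<^bsub>coord_limit CHAR('k) m I\<^esub> ?\<phi> \<tau>"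
      if "\<sigma> \<in> carrier (tower_gal I)" "\<tau> \<in> carrier (tower_gal I)" for \<sigma> \<tau>
      unfolding inverse_limit_mult by (rule restrict_ext) (simp add: coords_mult[OF that])
  qed
  show inj: "inj_on ?\<phi> (carrier (tower_gal I))"
  proof (rule inj_onI)
    fix \<sigma> \<tau> assume *: "\<sigma> \<in> carrier (tower_gal I)" "\<tau> \<in> carrier (tower_gal I)" "?\<phi> \<sigma> = ?\<phi> \<tau>"
    show "\<sigma> = \<tau>"
      using fun_cong[OF *(3)] by (intro coords_inj[OF *(1,2)]) (metis restrict_apply')
  qed
  show "?\<phi> ` carrier (tower_gal I) = carrier (coord_limit CHAR('k) m I)"
  proof (intro subset_antisym image_subsetI coords_in_limit subsetI)
    fix s assume s: "s \<in> carrier (coord_limit CHAR('k) m I)"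
    obtain \<sigma> where \<sigma>: "\<sigma> \<in> carrier (tower_gal I)" "\<And>n. n \<in> I \<Longrightarrow> coords n \<sigma> = s n"
      by (rule coords_surj[OF s I]) blast
    have "s \<in> extensional I"
      using s unfolding inverse_limit_carrier by (simp add: PiE_iff)
    then have "s = ?\<phi> \<sigma>"
      by (rule extensionalityI[OF _ restrict_extensional]) (simp add: \<sigma>(2))
    then show "s \<in> ?\<phi> ` carrier (tower_gal I)"
      using \<sigma>(1) by (rule image_eqI)
  qed
qed

lemma homeomorphic_coord_limit:
  assumes I: "I \<noteq> {}"
  shows "homeomorphic_map (krull_topology (tower_field I) base_field)
    (inverse_limit_topology I (\<lambda>n. Zmod_power CHAR('k) (m * n)) (\<lambda>i j. first_coords (m * i)))
    (\<lambda>\<sigma>. \<lambda>n\<in>I. coords n \<sigma>)"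
    (is "homeomorphic_map ?X ?Y ?\<phi>")
proof -
  define \<psi> where "\<psi> = inv_into (carrier (tower_gal I)) ?\<phi>"
  have bij: "bij_betw ?\<phi> (carrier (tower_gal I)) (carrier (coord_limit CHAR('k) m I))"
    using iso_coord_limit[OF I] by (simp add: iso_def)
  have \<psi>: "\<psi> s \<in> carrier (tower_gal I)" "?\<phi> (\<psi> s) = s" if "s \<in> carrier (coord_limit CHAR('k) m I)" for s
    using that bij_betw_imp_surj_on[OF bij] inv_into_into[of s ?\<phi>] f_inv_into_f[of s ?\<phi>]
    unfolding \<psi>_def by simp_all
  note top = topspace_krull_topology topspace_inverse_limit_topology
  have "continuous_map ?X ?Y ?\<phi>"
    unfolding inverse_limit_topology_def continuous_map_in_subtopology continuous_map_componentwise
  proof (intro conjI ballI)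
    show "?\<phi> ` topspace ?X \<subseteq> extensional I" by auto
    show "?\<phi> \<in> topspace ?X \<rightarrow> carrier (coord_limit CHAR('k) m I)"
      unfolding top by (intro Pi_I coords_in_limit)
    fix n assume n: "n \<in> I"
    have "tower n \<in> tower_field I"
      using tower_in_preimages preimages_subset_tower_field[OF n] by blast
    then show "continuous_map ?X (discrete_topology (carrier (Zmod_power CHAR('k) (m * n))))
        (\<lambda>\<sigma>. ?\<phi> \<sigma> n)"
    proof (rule continuous_map_discrete_factor[OF continuous_map_krull_coordinate])
      show "?\<phi> \<sigma> n \<in> carrier (Zmod_power CHAR('k) (m * n))" if "\<sigma> \<in> topspace ?X" for \<sigma>
        using that n coords(1) unfolding top by simp
      \<comment> \<open>Coordinate \<open>n\<close> depends only on where the automorphism sends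
        \<open>tower n\<close>.\<close>
      show "?\<phi> \<sigma> n = ?\<phi> \<tau> n" if "\<sigma> (tower n) = \<tau> (tower n)" for \<sigma> \<tau>
        using n that by (simp add: coords_def displacement_def)
    qed
  qed
  moreover have "continuous_map ?Y ?X \<psi>"
    unfolding krull_topology_def continuous_map_in_subtopology continuous_map_componentwise
  proof (intro conjI ballI)
    show "\<psi> ` topspace ?Y \<subseteq> extensional (tower_field I)"
      unfolding top using gal_groupD(2)[OF \<psi>(1)] by blast
    show "\<psi> \<in> topspace ?Y \<rightarrow> carrier (tower_gal I)"
      unfolding top by (intro Pi_I \<psi>(1))
    fix x assume x: "x \<in> tower_field I"
    then obtain n where n: "n \<in> I" "x \<in> splitting f n"
      unfolding tower_field_def by blast
    show "continuous_map ?Y (discrete_topology (tower_field I)) (\<lambda>s. \<psi> s x)"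
    proof (rule continuous_map_discrete_factor[OF continuous_map_inverse_limit_coordinate[OF n(1)]])
      show "\<psi> s x \<in> tower_field I" if "s \<in> topspace ?Y" for s
        using gal_groupD(4)[OF \<psi>(1) x] that unfolding top by blast
      \<comment> \<open>On \<open>splitting f n\<close> the automorphism is determined by its
        displacement at level \<open>n\<close>, hence by the coordinate \<open>s n\<close>.\<close>
      fix s s' assume "s \<in> topspace ?Y" "s' \<in> topspace ?Y" and eq: "s n = s' n"
      then have s: "s \<in> carrier (coord_limit CHAR('k) m I)" "s' \<in> carrier (coord_limit CHAR('k) m I)"
        unfolding top by blast+
      have "coords n (\<psi> r) = r n" if "r \<in> carrier (coord_limit CHAR('k) m I)" for r
        using fun_cong[OF \<psi>(2)[OF that], of n] n(1) by simp
      then have "displacement n (\<psi> s) = displacement n (\<psi> s')"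
        using coords(2)[OF \<psi>(1)[OF s(1)] n(1)] coords(2)[OF \<psi>(1)[OF s(2)] n(1)] s eq by simp
      then have "\<psi> s (tower n) = \<psi> s' (tower n)"
        using displacement(2)[OF \<psi>(1)[OF s(1)] n(1)] displacement(2)[OF \<psi>(1)[OF s(2)] n(1)] by simp
      then show "\<psi> s x = \<psi> s' x"
        by (rule tower_gal_determined[OF \<psi>(1)[OF s(1)] \<psi>(1)[OF s(2)] n(1) tower_in_preimages _ n(2)])
    qed
  qed
  moreover have "\<psi> (?\<phi> \<sigma>) = \<sigma>" if "\<sigma> \<in> carrier (tower_gal I)" for \<sigma>
    unfolding \<psi>_def by (rule inv_into_f_f[OF bij_betw_imp_inj_on[OF bij] that])
  ultimately have "homeomorphic_maps ?X ?Y ?\<phi> \<psi>"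
    unfolding homeomorphic_maps_def top using \<psi>(2) by blast
  then show ?thesis
    unfolding homeomorphic_map_maps by blast
qed

section \<open>The finite monodromy groups, their free action, and the infinite level\<close>

lemma Mon_eq: "Mon f n = tower_gal {n}"
  by (simp add: Mon_def tower_field_def)

lemma IMG_eq: "IMG f = tower_gal {1..}"
  by (simp add: IMG_def splitting_inf_def tower_field_def)

lemma IMG_topology_eq: "IMG_topology f = krull_topology (tower_field {1..}) base_field"
  by (simp add: IMG_topology_def splitting_inf_def tower_field_def)

lemma Mon_iso: "Mon f n \<cong> Zmod_power CHAR('k) (m * n)"
proof (rule is_isoI)
  show "coords n \<in> iso (Mon f n) (Zmod_power CHAR('k) (m * n))"
    unfolding Mon_eq iso_iff
  proof (intro conjI)
    have n: "n \<in> {n}" by simp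
    show "coords n \<in> hom (tower_gal {n}) (Zmod_power CHAR('k) (m * n))"
      by (intro homI coords(1)[OF _ n] coords_mult[OF _ _ n])
    show "inj_on (coords n) (carrier (tower_gal {n}))"
      by (intro inj_onI coords_inj[of _ "{n}"]) simp_all
    show "coords n ` carrier (tower_gal {n}) = carrier (Zmod_power CHAR('k) (m * n))"
    proof (intro subset_antisym image_subsetI coords(1)[OF _ n] subsetI)
      fix x assume x: "x \<in> carrier (Zmod_power CHAR('k) (m * n))"
      \<comment> \<open>With the single index \<open>n\<close>, the only compatibility condition is
        for the transition map from \<open>n\<close> to itself, which must fix
        \<open>x\<close>.\<close>
      then have "first_coords (m * n) x = x"
        by (auto simp: first_coords_def carrier_Zmod_power[OF char_pos] PiE_iff extensional_restrict)
      then have "(\<lambda>i\<in>{n}. x) \<in> carrier (coord_limit CHAR('k) m {n})"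
        using x unfolding inverse_limit_carrier by simp
      then obtain \<sigma> where \<sigma>: "\<sigma> \<in> carrier (tower_gal {n})"
        and "\<And>i. i \<in> {n} \<Longrightarrow> coords i \<sigma> = (\<lambda>i\<in>{n}. x) i"
        by (rule coords_surj[OF _ insert_not_empty]) blast
      from this(2)[OF n] have "x = coords n \<sigma>"
        by simp
      then show "x \<in> coords n ` carrier (tower_gal {n})"
        using \<sigma> by (rule image_eqI)
    qed
  qed
qed

text \<open>For surjectivity, let \<sigma> send \<open>x\<close> to the preimage \<open>y\<close>.
  Then \<sigma> sends both the iterate of \<open>f\<close> at \<open>x\<close> and
  \<open>t_omega\<close> to \<open>t_omega\<close>, so by injectivity \<open>x\<close> is itself a
  preimage.\<close>

lemma bij_betw_preimages:
  assumes \<sigma>: "\<sigma> \<in> carrier (tower_gal I)" and n: "n \<in> I"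
  shows "bij_betw \<sigma> (preimages f n) (preimages f n)"
proof (rule bij_betw_imageI)
  have I: "I \<noteq> {}" using n by blast
  have bij: "bij_betw \<sigma> (tower_field I) (tower_field I)"
    using gal_groupD(1)[OF \<sigma>] by (simp add: Bij_def)
  note sub = preimages_subset_tower_field[OF n]
  show "inj_on \<sigma> (preimages f n)"
    using bij_betw_imp_inj_on[OF bij] sub by (rule inj_on_subset)
  show "\<sigma> ` preimages f n = preimages f n"
  proof (intro subset_antisym image_subsetI subsetI)
    show "\<sigma> x \<in> preimages f n" if "x \<in> preimages f n" for x
      using \<sigma> n that by (rule tower_gal_preimages)
    fix y assume y: "y \<in> preimages f n"
    then have "y \<in> \<sigma> ` tower_field I"
      using sub bij_betw_imp_surj_on[OF bij] by blast
    then obtain x where x: "x \<in> tower_field I" "y = \<sigma> x" by blast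
    have t: "t_omega \<in> base_field"
      using generator_in_rat_field by (simp add: base_field_eq)
    have ev: "ev (iterate_poly f n) x \<in> tower_field I"
      using const_omega_splitting splitting_subset_tower_field[OF n]
      by (intro ev_in_subfield[OF subfield_tower_field[OF I] _ x(1)]) (rule subset_trans)
    have "\<sigma> (ev (iterate_poly f n) x) = \<sigma> t_omega"
      unfolding tower_gal_ev[OF \<sigma> I x(1)] gal_groupD(7)[OF \<sigma> t]
      using y by (simp add: preimages_eq x(2))
    then have "ev (iterate_poly f n) x = t_omega"
      using t base_field_subset_tower_field[OF I]
      by (intro inj_onD[OF bij_betw_imp_inj_on[OF bij] _ ev]) blast+
    then show "y \<in> \<sigma> ` preimages f n"
      unfolding x(2) by (intro imageI) (simp add: preimages_eq)
  qed
qed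

lemma Mon_action: "group_action (Mon f n) (preimages f n) (mon_action f n)"
proof (intro group_action.intro group_hom.intro group_Mon group_BijGroup group_hom_axioms.intro homI)
  fix \<sigma> assume \<sigma>: "\<sigma> \<in> carrier (Mon f n)"
  then show act: "mon_action f n \<sigma> \<in> carrier (BijGroup (preimages f n))"
    using bij_betw_preimages[of \<sigma> "{n}" n]
    by (simp add: Mon_eq BijGroup_def Bij_def mon_action_def bij_betw_restrict_eq)
  fix \<tau> assume \<tau>: "\<tau> \<in> carrier (Mon f n)"
  then have act': "mon_action f n \<tau> \<in> carrier (BijGroup (preimages f n))"
    using bij_betw_preimages[of \<tau> "{n}" n]
    by (simp add: Mon_eq BijGroup_def Bij_def mon_action_def bij_betw_restrict_eq)
  \<comment> \<open>\<open>BijGroup\<close> composes extensional maps on the preimages, whereas the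
    Galois product is extensional on the whole field; both agree because \<tau> preserves the
    preimages.\<close>
  have "restrict (compose (tower_field {n}) \<sigma> \<tau>) (preimages f n)
      = compose (preimages f n) (restrict \<sigma> (preimages f n)) (restrict \<tau> (preimages f n))"
  proof (rule extensionalityI[of _ "preimages f n"])
    fix x assume x: "x \<in> preimages f n"
    then have "\<tau> x \<in> preimages f n" "x \<in> tower_field {n}"
      using \<tau> tower_gal_preimages[of \<tau> "{n}" n x] preimages_subset_tower_field[of n "{n}"]
      by (auto simp: Mon_eq)
    then show "restrict (compose (tower_field {n}) \<sigma> \<tau>) (preimages f n) x
        = compose (preimages f n) (restrict \<sigma> (preimages f n)) (restrict \<tau> (preimages f n)) x"
      using x by (simp add: compose_eq)
  qed simp_all
  then show "mon_action f n (\<sigma> \<otimes>\<^bsub>Mon f n\<^esub> \<tau>)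
      = mon_action f n \<sigma> \<otimes>\<^bsub>BijGroup (preimages f n)\<^esub> mon_action f n \<tau>"
    using \<sigma> \<tau> act act' gal_group_mult[of \<sigma> "tower_field {n}" base_field \<tau>]
    by (simp add: Mon_eq BijGroup_def mon_action_def)
qed

text \<open>An automorphism that agrees with the identity at one preimage agrees with it on the
  field generated by that preimage, which is the whole splitting field.\<close>

lemma Mon_stabilizer:
  assumes \<alpha>: "\<alpha> \<in> preimages f n"
  shows "stabilizer (Mon f n) (mon_action f n) \<alpha> = {\<one>\<^bsub>Mon f n\<^esub>}"
proof -
  interpret group "Mon f n" by (rule group_Mon)
  let ?L = "tower_field {n}"
  have n: "n \<in> {n}" by simp
  have one: "\<one>\<^bsub>Mon f n\<^esub> = (\<lambda>x\<in>?L. x)"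
    by (simp add: Mon_eq gal_group_def BijGroup_def)
  have \<alpha>L: "\<alpha> \<in> ?L"
    using \<alpha> preimages_subset_tower_field[OF n] by blast
  have one_in: "\<one>\<^bsub>Mon f n\<^esub> \<in> carrier (tower_gal {n})"
    unfolding Mon_eq[symmetric] by (rule one_closed)
  have "\<sigma> = \<one>\<^bsub>Mon f n\<^esub>" if \<sigma>: "\<sigma> \<in> carrier (tower_gal {n})" and fix\<alpha>: "\<sigma> \<alpha> = \<alpha>" for \<sigma>
  proof (rule extensionalityI[OF gal_groupD(2)[OF \<sigma>] gal_groupD(2)[OF one_in]])
    fix x assume "x \<in> ?L"
    then have "x \<in> splitting f n" by (simp add: tower_field_def)
    moreover have "\<sigma> \<alpha> = \<one>\<^bsub>Mon f n\<^esub> \<alpha>"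
      using fix\<alpha> \<alpha>L by (simp add: one)
    ultimately show "\<sigma> x = \<one>\<^bsub>Mon f n\<^esub> x"
      using tower_gal_determined[OF \<sigma> one_in n \<alpha>] by blast
  qed
  moreover have "\<one>\<^bsub>Mon f n\<^esub> \<alpha> = \<alpha>"
    using \<alpha>L by (simp add: one)
  ultimately show ?thesis
    using \<alpha> one_in unfolding stabilizer_def mon_action_def Mon_eq[symmetric] by auto
qed

lemma IMG_iso:
  "\<exists>\<phi> \<in> iso (IMG f) (coord_limit CHAR('k) m {1..}).
     homeomorphic_map (IMG_topology f)
       (inverse_limit_topology {1..} (\<lambda>n. Zmod_power CHAR('k) (m * n)) (\<lambda>i j. first_coords (m * i))) \<phi>"
  unfolding IMG_eq IMG_topology_eq
  by (intro bexI[OF _ iso_coord_limit] homeomorphic_coord_limit) simp_all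

end

theorem theorem1p4:
  fixes f :: "'p::prime_card mod_ring alg_closure poly" and m :: nat
  assumes "additive_poly f"
    and "rsquarefree f"
    and "Polynomial.degree f = CARD('p) ^ m" and "m \<ge> 1"
  shows "(\<forall>n\<ge>1.
            Mon f n \<cong> Zmod_power CARD('p) (m * n)
          \<and> group_action (Mon f n) (preimages f n) (mon_action f n)
          \<and> (\<forall>\<alpha>\<in>preimages f n. stabilizer (Mon f n) (mon_action f n) \<alpha> = {\<one>\<^bsub>Mon f n\<^esub>}))
       \<and> (\<exists>\<phi> \<in> iso (IMG f)
                 (inverse_limit {1..} (\<lambda>n. Zmod_power CARD('p) (m * n))
                                      (\<lambda>i j. first_coords (m * i))).
            homeomorphic_map (IMG_topology f)
              (inverse_limit_topology {1..} (\<lambda>n. Zmod_power CARD('p) (m * n))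
                                            (\<lambda>i j. first_coords (m * i))) \<phi>)"
proof -
  have char: "CHAR('p mod_ring alg_closure) = CARD('p)"
    by simp
  \<comment> \<open>The field \<open>k\<close> becomes the algebraic closure of the prime field with
    \<open>CARD('p)\<close> elements, and \<open>char\<close> identifies its characteristic.\<close>
  interpret separable_additive f m
    using assms(1-3) by unfold_locales (simp_all add: char)
  show ?thesis
    using Mon_iso Mon_action Mon_stabilizer IMG_iso unfolding char by blast
qed

end
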